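(* Let $G$ be a spinal graph. Then the normalized volume of the flow polytope $\mathcal F_G$ equals the number $A_G^{\uparrow}$ of upper $G$-cyclic orders and also equals the number $A_G^{\downarrow}$ of lower $G$-cyclic orders: $$\operatorname{vol}\mathcal F_G=A_G^{\uparrow}=A_G^{\downarrow}.$$
   Context: Spinal graph: a directed multigraph $G$ on vertex set $[n+1]=\{1,\dots,n+1\}$, all of whose edges $(i,i')$ go from a smaller vertex $i$ (the tail) to a larger vertex $i'$ (the head), containing at least one edge $(i,i+1)$ for each $i=1,\dots,n$. For each $i$ exactly one of the edges $(i,i+1)$ is designated the slack edge $x_i$; all other edges are non-slack. The $d$ non-slack edges are labeled $y_1,\dots,y_d$ in canonical order: increasing lexicographic order of the pairs (tail, head), with parallel edges ordered arbitrarily. Flow polytope: $\mathcal F_G\subset\mathbb R^{E(G)}$ is the set of tuples $(f_e)_{e\in E(G)}$ of nonnegative reals such that for $i=1,\dots,n+1$, $a_i+\sum_{\mathrm{head}(e)=i}f_e=\sum_{\mathrm{tail}(e)=i}f_e$, where $\mathbf a=\mathbf e_1-\mathbf e_{n+1}$. It is a lattice polytope of dimension $d$. The normalized volume $\operatorname{vol}$ of a $D$-dimensional lattice polytope is $D!$ times its volume, measured in its affine span so that a fundamental domain of the lattice of integer points of the affine span has volume $1$. Total cyclic order on a finite set $X$: a ternary relation $\gamma\subseteq X^3$ such that (a) $(x,y,z)\in\gamma\Rightarrow(y,z,x)\in\gamma$; (b) $(x,y,z)\in\gamma\Rightarrow(z,y,x)\notin\gamma$; (c) $(x,y,z),(x,z,u)\in\gamma\Rightarrow(x,y,u)\in\gamma$;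 (d) for all distinct $x,y,z$, $(x,y,z)\in\gamma$ or $(z,y,x)\in\gamma$. Equivalently, an arrangement of $X$ on a circle up to rotation, where $(x,y,z)\in\gamma$ means that reading clockwise from $x$ one meets $y$ before $z$. "Immediately before/after" refers to adjacency in clockwise reading. For $j\in[d]$, an index $k\in[j]$ is active at $j$ if $\mathrm{head}(y_k)\le\mathrm{tail}(y_j)$ and inactive at $j$ otherwise; $\mathrm{ACT}(j)$ is the set of active indices at $j$ together with $0$, and $\mathrm{INACT}(j)$ the set of inactive indices at $j$ (so they partition $\{0,\dots,j\}$). For a total cyclic order $\gamma$ on $\{0,1,\dots,d\}$ let $\mathrm{skip}(j)=|\{z\in\mathrm{ACT}(j):(j-1,z,j)\in\gamma\}|$. $\gamma$ is a $G$-cyclic order if for all $j\in[d]$, $\sum_{k\in\mathrm{INACT}(j)}\mathrm{skip}(k)<|\mathrm{ACT}(j)|$. Let $\gamma|_j$ be the restriction of $\gamma$ to $\{0,1,\dots,j\}$. A $G$-cyclic order $\gamma$ is an upper $G$-cyclic order if for every $j\in[d]$, $j$ occurs in $\gamma|_j$ immediately before an entry active at $j$ (an element of $\mathrm{ACT}(j)$). It is a lower $G$-cyclic order if for every $j\in[d]$, $j$ occurs in $\gamma|_j$ immediately after $j-1$ or immediately after an entry active at $j$. *)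

theory Defs
  imports "HOL-Analysis.Analysis" "Graph_Theory.Digraph"
begin

section \<open>Spinal graphs\<close>

text \<open>The vertex set is \<open>{1..n+1}\<close>, and \<open>x i\<close> is the slack edge from \<open>i\<close> to \<open>i + 1\<close>.\<close>

locale spinal_graph = fin_digraph G for G :: "(nat, 'e) pre_digraph" +
  fixes n :: nat and x :: "nat \<Rightarrow> 'e"
  assumes verts_eq: "verts G = {1..n+1}"
    and tail_less_head: "e \<in> arcs G \<Longrightarrow> tail G e < head G e"
    and slack_in_arcs: "i \<in> {1..n} \<Longrightarrow> x i \<in> arcs G"
    and tail_slack: "i \<in> {1..n} \<Longrightarrow> tail G (x i) = i"
    and head_slack: "i \<in> {1..n} \<Longrightarrow> head G (x i) = i + 1"

text \<open>
  \<open>y 1, \<dots>, y d\<close> lists the non-slack edges in increasing lexicographic order of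
  (tail, head); parallel edges may come in any order.
\<close>

definition canonical_labeling ::
  "(nat, 'e) pre_digraph \<Rightarrow> nat \<Rightarrow> (nat \<Rightarrow> 'e) \<Rightarrow> nat \<Rightarrow> (nat \<Rightarrow> 'e) \<Rightarrow> bool" where
  "canonical_labeling G n x d y \<longleftrightarrow>
     bij_betw y {1..d} (arcs G - x ` {1..n}) \<and>
     (\<forall>j\<in>{1..d}. \<forall>k\<in>{1..d}. j < k \<longrightarrow>
        tail G (y j) < tail G (y k) \<or>
        (tail G (y j) = tail G (y k) \<and> head G (y j) \<le> head G (y k)))"


section \<open>Flow polytopes and normalized volume\<close>

definition netflow :: "nat \<Rightarrow> nat \<Rightarrow> real" where
  "netflow n i = of_bool (i = 1) - of_bool (i = n + 1)"

text \<open>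
  The space of real tuples indexed by \<open>arcs G\<close> is the coordinate subspace of
  \<open>real ^ 'e\<close> whose coordinates outside \<open>arcs G\<close> vanish.
\<close>

definition flow_polytope :: "(nat, 'e::finite) pre_digraph \<Rightarrow> nat \<Rightarrow> (real ^ 'e) set" where
  "flow_polytope G n =
     {f. (\<forall>e. e \<notin> arcs G \<longrightarrow> f $ e = 0) \<and>
         (\<forall>e\<in>arcs G. 0 \<le> f $ e) \<and>
         (\<forall>i\<in>{1..n+1}. netflow n i + (\<Sum>e\<in>in_arcs G i. f $ e) = (\<Sum>e\<in>out_arcs G i. f $ e))}"

definition integer_points :: "(real ^ 'e::finite) set" where
  "integer_points = {z. \<forall>e. z $ e \<in> \<int>}"

text \<open>
  \<open>p\<close> is an integer point of the affine space \<open>A\<close>, and \<open>B\<close> is a lattice basis of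
  the integer points of \<open>A\<close> translated by \<open>- p\<close>.
\<close>

definition lattice_frame ::
  "(real ^ 'e::finite) set \<Rightarrow> (real ^ 'e) \<times> (real ^ 'e) set \<Rightarrow> bool" where
  "lattice_frame A = (\<lambda>(p, B).
     independent B \<and>
     A \<inter> integer_points = range (\<lambda>c :: real ^ 'e \<Rightarrow> int. p + (\<Sum>b\<in>B. of_int (c b) *\<^sub>R b)))"

text \<open>
  Volume in the affine span of \<open>P\<close>, scaled so that a fundamental domain of the lattice
  of integer points of the span has volume 1: Lebesgue measure on \<open>\<real>\<^sup>B\<close>, carried over by
  lattice coordinates, which map the fundamental parallelepiped to the unit cube.
  The value does not depend on the frame, since two frames differ by a unimodular
  affine transformation. It is meaningful when the integer points of the affine span
  affinely span it, as for every nonempty lattice polytope.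
\<close>

definition relative_volume :: "(real ^ 'e::finite) set \<Rightarrow> real" where
  "relative_volume P =
     (let (p, B) = (SOME F. lattice_frame (affine hull P) F) in
        measure (Pi\<^sub>M B (\<lambda>_. lborel))
          {c \<in> B \<rightarrow>\<^sub>E (UNIV :: real set). p + (\<Sum>b\<in>B. c b *\<^sub>R b) \<in> P})"

definition normalized_volume :: "(real ^ 'e::finite) set \<Rightarrow> real" where
  "normalized_volume P = fact (nat (aff_dim P)) * relative_volume P"


section \<open>Cyclic orders\<close>

definition total_cyclic_order_on :: "'a set \<Rightarrow> ('a \<times> 'a \<times> 'a) set \<Rightarrow> bool" where
  "total_cyclic_order_on X \<gamma> \<longleftrightarrow>
     \<gamma> \<subseteq> X \<times> X \<times> X \<and>
     (\<forall>x y z. (x, y, z) \<in> \<gamma> \<longrightarrow> (y, z, x) \<in> \<gamma>) \<and>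
     (\<forall>x y z. (x, y, z) \<in> \<gamma> \<longrightarrow> (z, y, x) \<notin> \<gamma>) \<and>
     (\<forall>x y z u. (x, y, z) \<in> \<gamma> \<and> (x, z, u) \<in> \<gamma> \<longrightarrow> (x, y, u) \<in> \<gamma>) \<and>
     (\<forall>x\<in>X. \<forall>y\<in>X. \<forall>z\<in>X. x \<noteq> y \<and> y \<noteq> z \<and> x \<noteq> z \<longrightarrow> (x, y, z) \<in> \<gamma> \<or> (z, y, x) \<in> \<gamma>)"

text \<open>
  The set \<open>X\<close> has to be given, as the empty relation is the total cyclic order of every
  set with at most two elements. The next notion is only used when \<open>X\<close> has at least two
  elements.
\<close>

definition immediately_before :: "'a set \<Rightarrow> ('a \<times> 'a \<times> 'a) set \<Rightarrow> 'a \<Rightarrow> 'a \<Rightarrow> bool" where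
  "immediately_before X \<gamma> a b \<longleftrightarrow>
     a \<in> X \<and> b \<in> X \<and> a \<noteq> b \<and> \<not> (\<exists>z\<in>X. (a, z, b) \<in> \<gamma>)"

abbreviation immediately_after :: "'a set \<Rightarrow> ('a \<times> 'a \<times> 'a) set \<Rightarrow> 'a \<Rightarrow> 'a \<Rightarrow> bool" where
  "immediately_after X \<gamma> a b \<equiv> immediately_before X \<gamma> b a"

definition restrict_order :: "(nat \<times> nat \<times> nat) set \<Rightarrow> nat \<Rightarrow> (nat \<times> nat \<times> nat) set" where
  "restrict_order \<gamma> j = \<gamma> \<inter> ({0..j} \<times> {0..j} \<times> {0..j})"

definition active :: "(nat, 'e) pre_digraph \<Rightarrow> (nat \<Rightarrow> 'e) \<Rightarrow> nat \<Rightarrow> nat \<Rightarrow> bool" where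
  "active G y j k \<longleftrightarrow> head G (y k) \<le> tail G (y j)"

definition ACT :: "(nat, 'e) pre_digraph \<Rightarrow> (nat \<Rightarrow> 'e) \<Rightarrow> nat \<Rightarrow> nat set" where
  "ACT G y j = insert 0 {k \<in> {1..j}. active G y j k}"

definition INACT :: "(nat, 'e) pre_digraph \<Rightarrow> (nat \<Rightarrow> 'e) \<Rightarrow> nat \<Rightarrow> nat set" where
  "INACT G y j = {k \<in> {1..j}. \<not> active G y j k}"

definition skip ::
  "(nat, 'e) pre_digraph \<Rightarrow> (nat \<Rightarrow> 'e) \<Rightarrow> (nat \<times> nat \<times> nat) set \<Rightarrow> nat \<Rightarrow> nat" where
  "skip G y \<gamma> j = card {z \<in> ACT G y j. (j - 1, z, j) \<in> \<gamma>}"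

definition G_cyclic_order ::
  "(nat, 'e) pre_digraph \<Rightarrow> nat \<Rightarrow> (nat \<Rightarrow> 'e) \<Rightarrow> (nat \<times> nat \<times> nat) set \<Rightarrow> bool" where
  "G_cyclic_order G d y \<gamma> \<longleftrightarrow>
     total_cyclic_order_on {0..d} \<gamma> \<and>
     (\<forall>j\<in>{1..d}. (\<Sum>k\<in>INACT G y j. skip G y \<gamma> k) < card (ACT G y j))"

definition upper_G_cyclic_order ::
  "(nat, 'e) pre_digraph \<Rightarrow> nat \<Rightarrow> (nat \<Rightarrow> 'e) \<Rightarrow> (nat \<times> nat \<times> nat) set \<Rightarrow> bool" where
  "upper_G_cyclic_order G d y \<gamma> \<longleftrightarrow>
     G_cyclic_order G d y \<gamma> \<and>
     (\<forall>j\<in>{1..d}. \<exists>k\<in>ACT G y j. immediately_before {0..j} (restrict_order \<gamma> j) j k)"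

definition lower_G_cyclic_order ::
  "(nat, 'e) pre_digraph \<Rightarrow> nat \<Rightarrow> (nat \<Rightarrow> 'e) \<Rightarrow> (nat \<times> nat \<times> nat) set \<Rightarrow> bool" where
  "lower_G_cyclic_order G d y \<gamma> \<longleftrightarrow>
     G_cyclic_order G d y \<gamma> \<and>
     (\<forall>j\<in>{1..d}.
        immediately_after {0..j} (restrict_order \<gamma> j) j (j - 1) \<or>
        (\<exists>k\<in>ACT G y j. immediately_after {0..j} (restrict_order \<gamma> j) j k))"

definition A_upper :: "(nat, 'e) pre_digraph \<Rightarrow> nat \<Rightarrow> (nat \<Rightarrow> 'e) \<Rightarrow> nat" where
  "A_upper G d y = card {\<gamma>. upper_G_cyclic_order G d y \<gamma>}"

definition A_lower :: "(nat, 'e) pre_digraph \<Rightarrow> nat \<Rightarrow> (nat \<Rightarrow> 'e) \<Rightarrow> nat" where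
  "A_lower G d y = card {\<gamma>. lower_G_cyclic_order G d y \<gamma>}"

end

theory Submission
  imports Defs
begin

text \<open>
  All three numbers count the vectors \<open>s\<close> of natural numbers with
  \<open>sum s (INACT j) < card (ACT j)\<close> for all \<open>j\<close>. A cyclic order is built by inserting
  \<open>1, \<dots>, d\<close> in turn, and each admissible value of \<open>skip j\<close> leaves exactly one upper and
  exactly one lower position for \<open>j\<close>, so these orders correspond to their skip vectors.

  For the volume, eliminate the slack edges: in the lattice coordinates given by the flows on
  \<open>y 1, \<dots>, y d\<close> the polytope is \<open>u \<ge> 0\<close>, \<open>sum u (INACT j) \<le> 1\<close>. Sweep along the spine
  and integrate out \<open>y k\<close> once its head is passed. The density of the flow on the current cut
  is a sum of products of divided powers \<open>u\<^sup>s / s!\<close>: an edge leaving the spine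
  expands the divided power of the slack variable by the binomial theorem, an edge joining it
  multiplies two divided powers by a Beta integral, and the exponents that occur along the way
  are exactly the vectors \<open>s\<close>, each contributing \<open>1 / d!\<close>.
\<close>

section \<open>Total cyclic orders\<close>

text \<open>Why each value leaves one position: cut the circle at \<open>j - 1\<close>, from which
  \<open>skip j\<close> is measured. A position of \<open>j\<close> is an initial segment of the
  resulting linear order. The segments allowed by the upper (or the lower) condition are nested and
  meet \<open>ACT j\<close> in sets of different sizes. For upper orders the sizes are exactly those
  below \<open>card (ACT j)\<close>. For lower orders, when \<open>j - 1\<close> is not in
  \<open>ACT j\<close>, the position right after \<open>j - 1\<close> supplies the otherwise missing
  size 0. Why each term is worth \<open>1 / d!\<close>: an integration raises the total degree by
  one and an opening preserves it, so the exponents of the open variables determine that of the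
  slack variable, which ends as 1 with exponent \<open>d\<close>. Divided powers keep all
  coefficients equal to 1, so terms only have to be counted. The obstacle on the volume side is that
  \<open>relative_volume\<close> picks its lattice frame by \<open>SOME\<close>. Independence of the
  frame is obtained from uniqueness of translation invariant measures, with no determinants of
  unimodular matrices.\<close>

definition cyc :: "('a \<Rightarrow> 'b::linorder) \<Rightarrow> 'a set \<Rightarrow> ('a \<times> 'a \<times> 'a) set" where
  "cyc r X = {(x, y, z). x \<in> X \<and> y \<in> X \<and> z \<in> X \<and>
     (r x < r y \<and> r y < r z \<or> r y < r z \<and> r z < r x \<or> r z < r x \<and> r x < r y)}"

lemma total_cyclic_order_on_cyc:
  assumes "inj_on r X"
  shows "total_cyclic_order_on X (cyc r X)"
  unfolding total_cyclic_order_on_def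
proof (intro conjI allI impI ballI)
  show "cyc r X \<subseteq> X \<times> X \<times> X" by (auto simp: cyc_def)
next
  fix x y z assume "(x, y, z) \<in> cyc r X"
  then show "(y, z, x) \<in> cyc r X" by (auto simp: cyc_def)
next
  fix x y z assume "(x, y, z) \<in> cyc r X"
  then show "(z, y, x) \<notin> cyc r X" by (auto simp: cyc_def)
next
  fix x y z u assume "(x, y, z) \<in> cyc r X \<and> (x, z, u) \<in> cyc r X"
  then show "(x, y, u) \<in> cyc r X" by (auto simp: cyc_def)
next
  fix x y z assume "x \<in> X" "y \<in> X" "z \<in> X" "x \<noteq> y \<and> y \<noteq> z \<and> x \<noteq> z"
  moreover from this have "r x \<noteq> r y" "r y \<noteq> r z" "r x \<noteq> r z"
    using assms by (auto dest: inj_onD)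
  ultimately show "(x, y, z) \<in> cyc r X \<or> (z, y, x) \<in> cyc r X"
    by (auto simp: cyc_def)
qed

text \<open>Distinctness is not an axiom: a triple with a repeated entry can be rotated so that the
  equal entries stand at its ends; it is then its own reversal, against asymmetry.\<close>

lemma total_cyclic_order_onD:
  assumes "total_cyclic_order_on X \<gamma>"
  shows "\<And>x y z. (x, y, z) \<in> \<gamma> \<Longrightarrow> x \<in> X \<and> y \<in> X \<and> z \<in> X \<and> x \<noteq> y \<and> y \<noteq> z \<and> x \<noteq> z"
    and "\<And>x y z. (x, y, z) \<in> \<gamma> \<Longrightarrow> (y, z, x) \<in> \<gamma>"
    and "\<And>x y z. (x, y, z) \<in> \<gamma> \<Longrightarrow> (z, y, x) \<notin> \<gamma>"
    and "\<And>x y z u. (x, y, z) \<in> \<gamma> \<Longrightarrow> (x, z, u) \<in> \<gamma> \<Longrightarrow> (x, y, u) \<in> \<gamma>"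
    and "\<And>x y z. x \<in> X \<Longrightarrow> y \<in> X \<Longrightarrow> z \<in> X \<Longrightarrow> x \<noteq> y \<Longrightarrow> y \<noteq> z \<Longrightarrow> x \<noteq> z \<Longrightarrow>
           (x, y, z) \<in> \<gamma> \<or> (z, y, x) \<in> \<gamma>"
proof -
  have sub: "\<gamma> \<subseteq> X \<times> X \<times> X"
    and rot: "\<forall>x y z. (x, y, z) \<in> \<gamma> \<longrightarrow> (y, z, x) \<in> \<gamma>"
    and asym: "\<forall>x y z. (x, y, z) \<in> \<gamma> \<longrightarrow> (z, y, x) \<notin> \<gamma>"
    and trans: "\<forall>x y z u. (x, y, z) \<in> \<gamma> \<and> (x, z, u) \<in> \<gamma> \<longrightarrow> (x, y, u) \<in> \<gamma>"
    and total: "\<forall>x\<in>X. \<forall>y\<in>X. \<forall>z\<in>X. x \<noteq> y \<and> y \<noteq> z \<and> x \<noteq> z \<longrightarrow> (x, y, z) \<in> \<gamma> \<or> (z, y, x) \<in> \<gamma>"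
    by (insert assms[unfolded total_cyclic_order_on_def], elim conjE, assumption)+
  show "(y, z, x) \<in> \<gamma>" if "(x, y, z) \<in> \<gamma>" for x y z using rot that by metis
  show "(z, y, x) \<notin> \<gamma>" if "(x, y, z) \<in> \<gamma>" for x y z using asym that by metis
  show "(x, y, u) \<in> \<gamma>" if "(x, y, z) \<in> \<gamma>" "(x, z, u) \<in> \<gamma>" for x y z u
    using trans that by metis
  show "(x, y, z) \<in> \<gamma> \<or> (z, y, x) \<in> \<gamma>"
    if "x \<in> X" "y \<in> X" "z \<in> X" "x \<noteq> y" "y \<noteq> z" "x \<noteq> z" for x y z
    using total that by metis
  show "x \<in> X \<and> y \<in> X \<and> z \<in> X \<and> x \<noteq> y \<and> y \<noteq> z \<and> x \<noteq> z" if "(x, y, z) \<in> \<gamma>" for x y z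
  proof -
    have "x \<in> X \<and> y \<in> X \<and> z \<in> X" using sub that by auto
    moreover have "(y, z, x) \<in> \<gamma>" "(z, x, y) \<in> \<gamma>" using rot that by metis+
    ultimately show ?thesis using asym that by metis
  qed
qed

section \<open>Linear ranks obtained by cutting the circle at a base point\<close>

definition base_rank :: "('a \<times> 'a \<times> 'a) set \<Rightarrow> 'a \<Rightarrow> 'a \<Rightarrow> nat" where
  "base_rank \<gamma> p z = (if z = p then 0 else Suc (card {w. (p, w, z) \<in> \<gamma>}))"

text \<open>By transitivity the set of elements between \<open>p\<close> and \<open>z\<close> grows
  as \<open>z\<close> moves clockwise, strictly because \<open>z\<close> itself is gained. The
  converse is totality. The case \<open>z = p\<close> is excluded since \<open>p\<close> has rank 0
  while no triple repeats an entry.\<close>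

lemma base_rank_less_iff:
  assumes "total_cyclic_order_on X \<gamma>" "finite X" "p \<in> X" "z \<in> X" "w \<in> X" "z \<noteq> p"
  shows "base_rank \<gamma> p z < base_rank \<gamma> p w \<longleftrightarrow> (p, z, w) \<in> \<gamma>"
proof -
  note D = total_cyclic_order_onD[OF assms(1)]
  have fin: "finite {v. (p, v, u) \<in> \<gamma>}" for u
    by (rule finite_subset[OF _ assms(2)]) (use D(1) in blast)
  have mono: "base_rank \<gamma> p a < base_rank \<gamma> p b" if "(p, a, b) \<in> \<gamma>" for a b
  proof -
    have "{v. (p, v, a) \<in> \<gamma>} \<subset> {v. (p, v, b) \<in> \<gamma>}"
      using that D(1,4) by blast
    then have "card {v. (p, v, a) \<in> \<gamma>} < card {v. (p, v, b) \<in> \<gamma>}"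
      using fin by (simp add: psubset_card_mono)
    then show ?thesis using D(1)[OF that] by (auto simp: base_rank_def)
  qed
  show ?thesis
  proof
    assume lt: "base_rank \<gamma> p z < base_rank \<gamma> p w"
    then have "w \<noteq> p" "z \<noteq> w" by (auto simp: base_rank_def split: if_splits)
    then have "(p, z, w) \<in> \<gamma> \<or> (w, z, p) \<in> \<gamma>"
      using D(5) assms(3-6) by metis
    moreover have False if "(w, z, p) \<in> \<gamma>"
      using mono[OF D(2)[OF D(2)[OF that]]] lt by simp
    ultimately show "(p, z, w) \<in> \<gamma>" by blast
  qed (rule mono)
qed

lemma inj_on_base_rank:
  assumes "total_cyclic_order_on X \<gamma>" "finite X" "p \<in> X"
  shows "inj_on (base_rank \<gamma> p) X"
proof (rule inj_onI, rule ccontr)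
  fix z w assume zw: "z \<in> X" "w \<in> X" "base_rank \<gamma> p z = base_rank \<gamma> p w" "z \<noteq> w"
  then have ne: "z \<noteq> p" "w \<noteq> p" by (auto simp: base_rank_def split: if_splits)
  then have "(p, z, w) \<in> \<gamma> \<or> (w, z, p) \<in> \<gamma>"
    using total_cyclic_order_onD(5)[OF assms(1)] assms(3) zw by metis
  then have "(p, z, w) \<in> \<gamma> \<or> (p, w, z) \<in> \<gamma>"
    using total_cyclic_order_onD(2)[OF assms(1)] by blast
  then show False
    using base_rank_less_iff[OF assms] zw ne by (metis less_irrefl)
qed

text \<open>The triples that start at \<open>p\<close> determine all others, so the ternary axioms
  can be traded for comparisons of ranks.\<close>

lemma eq_cyc_base_rank:
  assumes "total_cyclic_order_on X \<gamma>" "finite X" "p \<in> X"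
  shows "\<gamma> = cyc (base_rank \<gamma> p) X"
proof -
  note D = total_cyclic_order_onD[OF assms(1)]
  let ?r = "base_rank \<gamma> p"
  have less: "(p, z, w) \<in> \<gamma>" if "?r z < ?r w" "z \<in> X" "w \<in> X" "z \<noteq> p" for z w
    using base_rank_less_iff[OF assms] that by blast
  have pos: "?r z = 0 \<longleftrightarrow> z = p" for z by (simp add: base_rank_def)
  have incr: "(x, y, z) \<in> \<gamma>" if "?r x < ?r y" "?r y < ?r z" "x \<in> X" "y \<in> X" "z \<in> X" for x y z
  proof -
    have "y \<noteq> p" "z \<noteq> p" using that pos by (metis not_less_zero)+
    then have yz: "(p, y, z) \<in> \<gamma>" using less that by blast
    show ?thesis
    proof (cases "x = p")
      case False
      then have "(p, x, y) \<in> \<gamma>" using less that by blast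
      \<comment> \<open>Rotating to the base \<open>y\<close> lets transitivity chain
        \<open>(y, z, p)\<close> with \<open>(y, p, x)\<close>.\<close>
      then have "(y, p, x) \<in> \<gamma>" using D(2) by blast
      moreover have "(y, z, p) \<in> \<gamma>" using yz D(2) by blast
      ultimately have "(y, z, x) \<in> \<gamma>" by (meson D(4))
      then show ?thesis using D(2) by blast
    qed (use yz in simp)
  qed
  have sub: "cyc ?r X \<subseteq> \<gamma>"
  proof
    fix t assume "t \<in> cyc ?r X"
    then obtain x y z where t: "t = (x, y, z)" and X: "x \<in> X" "y \<in> X" "z \<in> X"
      and "?r x < ?r y \<and> ?r y < ?r z \<or> ?r y < ?r z \<and> ?r z < ?r x \<or> ?r z < ?r x \<and> ?r x < ?r y"
      by (auto simp: cyc_def)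
    then show "t \<in> \<gamma>" using incr[of x y z] incr[of y z x] incr[of z x y] D(2) by blast
  qed
  \<comment> \<open>One inclusion suffices: \<open>cyc\<close> is total, so it would contain the
    reversal of a missing triple, and by the first inclusion so would
    \<open>\<gamma>\<close>.\<close>
  moreover have "\<gamma> \<subseteq> cyc ?r X"
  proof (rule subsetI, rule ccontr)
    fix t assume t: "t \<in> \<gamma>" "t \<notin> cyc ?r X"
    obtain x y z where xyz: "t = (x, y, z)" by (cases t)
    have "(z, y, x) \<in> cyc ?r X"
      using total_cyclic_order_onD(5)[OF total_cyclic_order_on_cyc[OF inj_on_base_rank[OF assms]]]
        D(1) t unfolding xyz by blast
    then show False using sub D(3) t xyz by blast
  qed
  ultimately show ?thesis by blast
qed

section \<open>Extending a cyclic order by one element\<close>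

lemma base_rank_cong:
  assumes "\<And>w. (p, w, z) \<in> \<gamma> \<longleftrightarrow> (p, w, z) \<in> \<delta>"
  shows "base_rank \<gamma> p z = base_rank \<delta> p z"
  using assms by (simp add: base_rank_def)

lemma cyc_cong: "(\<And>z. z \<in> X \<Longrightarrow> r z = r' z) \<Longrightarrow> cyc r X = cyc r' X"
  by (auto simp: cyc_def)

lemma total_cyclic_order_on_restrict:
  assumes "total_cyclic_order_on Y \<gamma>" "X \<subseteq> Y"
  shows "total_cyclic_order_on X (\<gamma> \<inter> X \<times> X \<times> X)"
proof -
  note D = total_cyclic_order_onD[OF assms(1)]
  let ?\<gamma> = "\<gamma> \<inter> X \<times> X \<times> X"
  have "?\<gamma> \<subseteq> X \<times> X \<times> X" by simp
  moreover have "\<forall>x y z. (x, y, z) \<in> ?\<gamma> \<longrightarrow> (y, z, x) \<in> ?\<gamma>"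
    using D(2) by simp
  moreover have "\<forall>x y z. (x, y, z) \<in> ?\<gamma> \<longrightarrow> (z, y, x) \<notin> ?\<gamma>"
    using D(3) by simp
  moreover have "\<forall>x y z u. (x, y, z) \<in> ?\<gamma> \<and> (x, z, u) \<in> ?\<gamma> \<longrightarrow> (x, y, u) \<in> ?\<gamma>"
    using D(4) by (metis IntE IntI SigmaD1 SigmaD2 SigmaI)
  moreover have "\<forall>x\<in>X. \<forall>y\<in>X. \<forall>z\<in>X. x \<noteq> y \<and> y \<noteq> z \<and> x \<noteq> z \<longrightarrow> (x, y, z) \<in> ?\<gamma> \<or> (z, y, x) \<in> ?\<gamma>"
  proof (intro ballI impI)
    fix x y z assume *: "x \<in> X" "y \<in> X" "z \<in> X" "x \<noteq> y \<and> y \<noteq> z \<and> x \<noteq> z"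
    then show "(x, y, z) \<in> ?\<gamma> \<or> (z, y, x) \<in> ?\<gamma>"
      using D(5)[of x y z] assms(2) by auto
  qed
  ultimately show ?thesis
    unfolding total_cyclic_order_on_def by (intro conjI)
qed

text \<open>\<open>base_rank\<close> reads only triples that start at \<open>p\<close>. Those inside
  \<open>X\<close> are fixed by \<open>restr\<close>, those ending in \<open>q\<close> by
  \<open>D\<close>, and \<open>(p, q, z)\<close> holds exactly when \<open>(p, z, q)\<close> fails,
  for \<open>z\<close> in \<open>X\<close> other than \<open>p\<close>.\<close>

lemma cyclic_insert_unique:
  assumes \<gamma>: "total_cyclic_order_on (insert q X) \<gamma>" and \<delta>: "total_cyclic_order_on (insert q X) \<delta>"
    and "finite X" "p \<in> X" "q \<notin> X"
    and restr: "\<gamma> \<inter> X \<times> X \<times> X = \<delta> \<inter> X \<times> X \<times> X"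
    and D: "{z \<in> X. (p, z, q) \<in> \<gamma>} = {z \<in> X. (p, z, q) \<in> \<delta>}"
  shows "\<gamma> = \<delta>"
proof -
  note G = total_cyclic_order_onD[OF \<gamma>] and H = total_cyclic_order_onD[OF \<delta>]
  have X: "(p, w, z) \<in> \<gamma> \<longleftrightarrow> (p, w, z) \<in> \<delta>" if "w \<in> X" "z \<in> X" for w z
    using restr that assms(4) by blast
  have q: "(p, w, q) \<in> \<gamma> \<longleftrightarrow> (p, w, q) \<in> \<delta>" if "w \<in> X" for w
    using D that by blast
  have q': "(p, q, z) \<in> \<epsilon> \<longleftrightarrow> z \<noteq> p \<and> (p, z, q) \<notin> \<epsilon>"
    if "total_cyclic_order_on (insert q X) \<epsilon>" "z \<in> X" for z \<epsilon>
  proof -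
    note E = total_cyclic_order_onD[OF that(1)]
    have "p \<in> insert q X" "q \<in> insert q X" "z \<in> insert q X" "z \<noteq> q" "p \<noteq> q"
      using that assms by auto
    then show ?thesis
      using E(1)[of p q z] E(2)[of p q z] E(3)[of q z p] E(2)[of z q p] E(2)[of q p z] E(5)[of p q z]
      by metis
  qed
  have "(p, w, z) \<in> \<gamma> \<longleftrightarrow> (p, w, z) \<in> \<delta>" if z: "z \<in> insert q X" for w z
  proof (cases "w \<in> insert q X")
    case True
    with z consider "w \<in> X" "z \<in> X" | "w \<in> X" "z = q" | "w = q" "z \<in> X" | "w = q" "z = q"
      by blast
    then show ?thesis
    proof cases
      case 3
      then show ?thesis using q[of z] q'[OF \<gamma>, of z] q'[OF \<delta>, of z] by simp
    next
      case 4
      then show ?thesis using G(1)[of p w z] H(1)[of p w z] by blast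
    qed (simp_all add: X q)
  next
    case False
    then show ?thesis using G(1)[of p w z] H(1)[of p w z] by blast
  qed
  then have "cyc (base_rank \<gamma> p) (insert q X) = cyc (base_rank \<delta> p) (insert q X)"
    by (intro cyc_cong base_rank_cong)
  then show ?thesis
    using eq_cyc_base_rank[OF \<gamma>] eq_cyc_base_rank[OF \<delta>] assms(3,4) by simp
qed

lemma cyclic_insert_exists:
  assumes \<gamma>: "total_cyclic_order_on X \<gamma>" and "finite X" "p \<in> X" "q \<notin> X"
    and D: "D \<subseteq> X - {p}" "\<And>z w. (p, z, w) \<in> \<gamma> \<Longrightarrow> w \<in> D \<Longrightarrow> z \<in> D"
  shows "\<exists>\<delta>. total_cyclic_order_on (insert q X) \<delta> \<and> \<delta> \<inter> X \<times> X \<times> X = \<gamma> \<and>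
           {z \<in> X. (p, z, q) \<in> \<delta>} = D"
proof -
  note G = total_cyclic_order_onD[OF \<gamma>]
  let ?r = "base_rank \<gamma> p"
  \<comment> \<open>Doubling the old ranks frees the odd numbers. The elements of the initial
    segment \<open>D\<close> have the ranks 1 to \<open>card D\<close>, so this odd value puts
    \<open>q\<close> right behind them.\<close>
  define r where "r z = (if z = q then 2 * card D + 1 else 2 * ?r z)" for z
  define \<delta> where "\<delta> = cyc r (insert q X)"
  have rX: "r z = 2 * ?r z" if "z \<in> X" for z using that assms(4) by (auto simp: r_def)
  have rq: "r q = 2 * card D + 1" by (simp add: r_def)
  have finD: "finite D" using D(1) assms(2) finite_subset by blast
  have fin: "finite {w. (p, w, z) \<in> \<gamma>}" for z
    by (rule finite_subset[OF _ assms(2)]) (use G(1) in blast)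
  have le: "?r z \<le> card D \<longleftrightarrow> z \<in> D" if "z \<in> X" "z \<noteq> p" for z
  proof
    assume "?r z \<le> card D"
    then have "card {w. (p, w, z) \<in> \<gamma>} < card D" using that by (simp add: base_rank_def)
    then have "\<not> D \<subseteq> {w. (p, w, z) \<in> \<gamma>}" using card_mono[OF fin] by (metis leD)
    then obtain w where w: "w \<in> D" "(p, w, z) \<notin> \<gamma>" by blast
    have "z = w \<or> (p, z, w) \<in> \<gamma>"
      using G(5)[of p w z] G(2) w that assms(3) D(1) by blast
    then show "z \<in> D" using D(2) w by blast
  next
    assume "z \<in> D"
    then have "{w. (p, w, z) \<in> \<gamma>} \<subset> D" using D(2) G(1) by blast
    then show "?r z \<le> card D"
      using that psubset_card_mono[OF finD] by (simp add: base_rank_def Suc_le_eq)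
  qed
  have "2 * a < 2 * b + 1 \<longleftrightarrow> a \<le> b" for a b :: nat by presburger
  then have rD: "r z < r q \<longleftrightarrow> z \<in> D" if "z \<in> X" "z \<noteq> p" for z
    using le[OF that] rX[OF that(1)] rq by simp
  have "inj_on ?r X" by (rule inj_on_base_rank) fact+
  then have "inj_on r X" using rX by (simp add: inj_on_def)
  moreover have "r q \<notin> r ` X"
  proof
    assume "r q \<in> r ` X"
    then obtain z where "z \<in> X" "r q = r z" by blast
    then have "2 * card D + 1 = 2 * ?r z" using rX rq by simp
    then show False by presburger
  qed
  ultimately have "inj_on r (insert q X)" using assms(4) by simp
  then have 1: "total_cyclic_order_on (insert q X) \<delta>"
    unfolding \<delta>_def by (rule total_cyclic_order_on_cyc)
  have "\<delta> \<inter> X \<times> X \<times> X = cyc r X" by (auto simp: \<delta>_def cyc_def)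
  also have "\<dots> = cyc ?r X" by (auto simp: cyc_def rX)
  also have "\<dots> = \<gamma>" by (rule eq_cyc_base_rank[symmetric]) fact+
  finally have 2: "\<delta> \<inter> X \<times> X \<times> X = \<gamma>" .
  have rp: "r p = 0" using rX[OF assms(3)] by (simp add: base_rank_def)
  have rpos: "0 < r z" if "z \<in> X" "z \<noteq> p" for z
    using rX that by (simp add: base_rank_def)
  have "(p, z, q) \<in> \<delta> \<longleftrightarrow> z \<noteq> p \<and> r z < r q" if "z \<in> X" for z
    using rp rpos[of z] that assms(3) unfolding \<delta>_def cyc_def by auto
  then have "{z \<in> X. (p, z, q) \<in> \<delta>} = D" using rD D(1) by blast
  with 1 2 show ?thesis by blast
qed

text \<open>With the circle cut at \<open>p\<close>, the position of \<open>q\<close> is the set of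
  elements passed on the way from \<open>p\<close>. The base is the special case: right before
  \<open>p\<close> is the far end of the cut circle, right after \<open>p\<close> its
  beginning.\<close>

lemma immediately_before_new_iff:
  assumes \<gamma>: "total_cyclic_order_on (insert q X) \<gamma>" and "finite X" "p \<in> X" "q \<notin> X" "a \<in> X"
  shows "immediately_before (insert q X) \<gamma> q a \<longleftrightarrow>
    {z \<in> X. (p, z, q) \<in> \<gamma>} = (if a = p then X - {p} else {z \<in> X. (p, z, a) \<in> \<gamma>})"
    and "immediately_after (insert q X) \<gamma> q a \<longleftrightarrow>
    {z \<in> X. (p, z, q) \<in> \<gamma>} = (if a = p then {} else {z \<in> X. z = a \<or> (p, z, a) \<in> \<gamma>})"
proof -
  let ?Y = "insert q X"
  define r where "r = base_rank \<gamma> p"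
  have Y: "finite ?Y" "p \<in> ?Y" using assms by auto
  have inj: "inj_on r ?Y" unfolding r_def by (rule inj_on_base_rank[OF \<gamma> Y])
  have rp: "r p = 0" and rpos: "\<And>z. z \<noteq> p \<Longrightarrow> 0 < r z"
    by (auto simp: r_def base_rank_def)
  have p: "(p, z, w) \<in> \<gamma> \<longleftrightarrow> z \<noteq> p \<and> r z < r w" if "z \<in> ?Y" "w \<in> ?Y" for z w
    using base_rank_less_iff[OF \<gamma> Y] that total_cyclic_order_onD(1)[OF \<gamma>] unfolding r_def by metis
  have \<gamma>_eq: "\<gamma> = cyc r ?Y" unfolding r_def by (rule eq_cyc_base_rank[OF \<gamma> Y])
  have \<gamma>r: "(u, z, w) \<in> \<gamma> \<longleftrightarrow> r u < r z \<and> r z < r w \<or> r z < r w \<and> r w < r u \<or> r w < r u \<and> r u < r z"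
    if "u \<in> ?Y" "z \<in> ?Y" "w \<in> ?Y" for u z w
    using that by (simp add: \<gamma>_eq cyc_def)
  have ne: "r q \<noteq> r z" if "z \<in> X" for z using inj that assms(4) by (auto simp: inj_on_def)
  have nez: "r w \<noteq> r z" if "z \<in> X" "w \<in> X" "z \<noteq> w" for z w
    using inj that assms(4) by (auto simp: inj_on_def)
  have "q \<noteq> a" "q \<noteq> p" using assms(3-5) by metis+
  then have q: "q \<noteq> a" "q \<noteq> p" "0 < r q" "r q \<noteq> r a" using assms(5) rpos[of q] ne by auto
  have D: "{z \<in> X. (p, z, q) \<in> \<gamma>} = {z \<in> X. z \<noteq> p \<and> r z < r q}"
    "{z \<in> X. (p, z, a) \<in> \<gamma>} = {z \<in> X. z \<noteq> p \<and> r z < r a}"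
    "{z \<in> X. z = a \<or> (p, z, a) \<in> \<gamma>} = {z \<in> X. z = a \<or> z \<noteq> p \<and> r z < r a}"
    using p assms(5) by auto
  have before: "immediately_before ?Y \<gamma> q a \<longleftrightarrow>
     (\<forall>z\<in>X. \<not> (r q < r z \<and> r z < r a \<or> r z < r a \<and> r a < r q \<or> r a < r q \<and> r q < r z))"
    and after: "immediately_before ?Y \<gamma> a q \<longleftrightarrow>
     (\<forall>z\<in>X. \<not> (r a < r z \<and> r z < r q \<or> r z < r q \<and> r q < r a \<or> r q < r a \<and> r a < r z))"
    using \<gamma>r assms(5) q by (auto simp: immediately_before_def)
  show "immediately_before ?Y \<gamma> q a \<longleftrightarrow>
    {z \<in> X. (p, z, q) \<in> \<gamma>} = (if a = p then X - {p} else {z \<in> X. (p, z, a) \<in> \<gamma>})"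
  proof (cases "a = p")
    case True
    have "(\<forall>z\<in>X. \<not> r q < r z) \<longleftrightarrow> {z \<in> X. z \<noteq> p \<and> r z < r q} = X - {p}"
    proof -
      have "r z < r q \<longleftrightarrow> \<not> r q < r z" if "z \<in> X" for z using ne[OF that] by linarith
      moreover have "{z \<in> X. z \<noteq> p \<and> r z < r q} = X - {p} \<longleftrightarrow> (\<forall>z\<in>X. z \<noteq> p \<longrightarrow> r z < r q)" by blast
      ultimately show ?thesis using rp by auto
    qed
    then show ?thesis using True before D rp q by simp
  next
    case False
    have "(\<forall>z\<in>X. \<not> (r q < r z \<and> r z < r a \<or> r z < r a \<and> r a < r q \<or> r a < r q \<and> r q < r z)) \<longleftrightarrow>
      {z \<in> X. z \<noteq> p \<and> r z < r q} = {z \<in> X. z \<noteq> p \<and> r z < r a}" (is "?L \<longleftrightarrow> ?R")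
    proof
      assume L: ?L
      \<comment> \<open>The instance at \<open>p\<close>, which has rank 0: if \<open>a\<close> had
        smaller rank than \<open>q\<close>, reading clockwise from \<open>q\<close> would meet
        \<open>p\<close> before \<open>a\<close>.\<close>
      have "r q < r a" using L[rule_format, OF assms(3)] rp rpos[OF False] q by linarith
      then have "r z < r q \<longleftrightarrow> r z < r a" if "z \<in> X" for z
        using L[rule_format, OF that] ne[OF that] by linarith
      then show ?R by blast
    next
      assume R: ?R
      have "a \<notin> {z \<in> X. z \<noteq> p \<and> r z < r q}" unfolding R by simp
      then have "r q < r a" using False assms(5) q by auto
      have "r z < r q \<longleftrightarrow> r z < r a" if "z \<in> X" for z
      proof (cases "z = p")
        case False
        have "z \<in> {z \<in> X. z \<noteq> p \<and> r z < r q} \<longleftrightarrow> z \<in> {z \<in> X. z \<noteq> p \<and> r z < r a}"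
          by (simp only: R)
        then show ?thesis using that False by simp
      qed (use rp q \<open>r q < r a\<close> in simp)
      then show ?L using \<open>r q < r a\<close> by (metis less_asym)
    qed
    then show ?thesis using False before D by simp
  qed
  show "immediately_before ?Y \<gamma> a q \<longleftrightarrow>
    {z \<in> X. (p, z, q) \<in> \<gamma>} = (if a = p then {} else {z \<in> X. z = a \<or> (p, z, a) \<in> \<gamma>})"
  proof (cases "a = p")
    case True
    have "(\<forall>z\<in>X. \<not> (r p < r z \<and> r z < r q)) \<longleftrightarrow> {z \<in> X. z \<noteq> p \<and> r z < r q} = {}"
    proof -
      have "z \<noteq> p \<longleftrightarrow> r p < r z" for z using rp rpos[of z] by (cases "z = p") simp_all
      then show ?thesis by blast
    qed
    then show ?thesis using True after D rp q by simp
  next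
    case False
    have "(\<forall>z\<in>X. \<not> (r a < r z \<and> r z < r q \<or> r z < r q \<and> r q < r a \<or> r q < r a \<and> r a < r z)) \<longleftrightarrow>
      {z \<in> X. z \<noteq> p \<and> r z < r q} = {z \<in> X. z = a \<or> z \<noteq> p \<and> r z < r a}" (is "?L \<longleftrightarrow> ?R")
    proof
      assume L: ?L
      have "r a < r q" using L[rule_format, OF assms(3)] rp rpos[OF False] q by linarith
      then have "r z < r q \<longleftrightarrow> z = a \<or> r z < r a" if "z \<in> X" for z
        using L[rule_format, OF that] ne[OF that] nez[OF assms(5) that] by (cases "z = a") auto
      then show ?R using False by blast
    next
      assume R: ?R
      have "a \<in> {z \<in> X. z \<noteq> p \<and> r z < r q}" unfolding R using assms(5) by simp
      then have "r a < r q" by simp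
      have "r z < r q \<longleftrightarrow> z = a \<or> r z < r a" if "z \<in> X" for z
      proof (cases "z = p")
        case False
        have "z \<in> {z \<in> X. z \<noteq> p \<and> r z < r q} \<longleftrightarrow> z \<in> {z \<in> X. z = a \<or> z \<noteq> p \<and> r z < r a}"
          by (simp only: R)
        then show ?thesis using that False by simp
      qed (use rp q rpos[OF False] in simp)
      then show ?L using \<open>r a < r q\<close> by (metis less_asym less_irrefl)
    qed
    then show ?thesis using False after D by simp
  qed
qed

section \<open>Counting the admissible positions of a new element\<close>

lemma bij_betw_rank:
  fixes u :: "'a \<Rightarrow> 'b::linorder"
  assumes "finite A" "inj_on u A"
  shows "bij_betw (\<lambda>a. card {z \<in> A. u z < u a}) A {..<card A}"
proof -
  let ?f = "\<lambda>a. card {z \<in> A. u z < u a}"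
  have less: "?f a < ?f b" if "a \<in> A" "u a < u b" for a b
    using that assms(1) by (intro psubset_card_mono) (auto dest: less_trans)
  have inj: "inj_on ?f A"
  proof (rule inj_onI)
    fix a b assume "a \<in> A" "b \<in> A" "?f a = ?f b"
    then have "\<not> u a < u b" "\<not> u b < u a" using less[of a b] less[of b a] by linarith+
    then have "u a = u b" by simp
    then show "a = b" using assms(2) \<open>a \<in> A\<close> \<open>b \<in> A\<close> by (simp add: inj_on_eq_iff)
  qed
  have "?f a < card A" if "a \<in> A" for a
    using that assms(1) by (intro psubset_card_mono) auto
  then have "?f ` A \<subseteq> {..<card A}" by auto
  then have "?f ` A = {..<card A}"
    using card_image[OF inj] by (simp add: card_subset_eq)
  with inj show ?thesis by (simp add: bij_betw_def)
qed

lemma ex1_rank: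
  fixes u :: "'a \<Rightarrow> 'b::linorder"
  assumes "finite A" "inj_on u A" "m < card A"
  shows "\<exists>!a. a \<in> A \<and> card {z \<in> A. u z < u a} = m"
proof -
  let ?f = "\<lambda>a. card {z \<in> A. u z < u a}"
  have bij: "inj_on ?f A" "?f ` A = {..<card A}"
    using bij_betw_rank[OF assms(1,2)] by (simp_all add: bij_betw_def)
  have "m \<in> ?f ` A" unfolding bij(2) using assms(3) by simp
  then obtain a where a: "m = ?f a" "a \<in> A" by (rule imageE)
  show ?thesis
  proof (rule ex1I[of _ a])
    fix b assume b: "b \<in> A \<and> ?f b = m"
    then have "?f b = ?f a" using a(1) by simp
    with bij(1) show "b = a" by (rule inj_onD) (use a b in simp_all)
  qed (use a in simp)
qed

text \<open>
  Cutting the circle at \<open>p\<close> makes \<open>\<gamma>\<close> a linear order, and inserting \<open>q\<close> amounts to choosing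
  the initial segment that precedes it.
\<close>

lemma cyclic_insert_ex1:
  assumes \<gamma>: "total_cyclic_order_on X \<gamma>" and X: "finite X" "p \<in> X" "q \<notin> X"
    and K: "\<exists>!a. a \<in> K \<and> card (A \<inter> D a) = m"
    and D: "\<And>a. a \<in> K \<Longrightarrow> D a \<subseteq> X - {p}"
      "\<And>a z w. a \<in> K \<Longrightarrow> (p, z, w) \<in> \<gamma> \<Longrightarrow> w \<in> D a \<Longrightarrow> z \<in> D a"
    and R: "\<And>a \<delta>. a \<in> K \<Longrightarrow> total_cyclic_order_on (insert q X) \<delta> \<Longrightarrow>
      \<delta> \<inter> X \<times> X \<times> X = \<gamma> \<Longrightarrow> R \<delta> a \<longleftrightarrow> {z \<in> X. (p, z, q) \<in> \<delta>} = D a"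
    and A: "A \<subseteq> X"
  shows "\<exists>!\<delta>. total_cyclic_order_on (insert q X) \<delta> \<and> \<delta> \<inter> X \<times> X \<times> X = \<gamma> \<and>
    (\<exists>a\<in>K. R \<delta> a) \<and> card {z \<in> A. (p, z, q) \<in> \<delta>} = m"
proof -
  obtain a where a: "a \<in> K" "card (A \<inter> D a) = m"
    and unique: "\<And>b. b \<in> K \<Longrightarrow> card (A \<inter> D b) = m \<Longrightarrow> b = a"
    using K by blast
  have skip: "{z \<in> A. (p, z, q) \<in> \<delta>} = A \<inter> {z \<in> X. (p, z, q) \<in> \<delta>}" for \<delta>
    using A by blast
  have "\<exists>\<delta>. total_cyclic_order_on (insert q X) \<delta> \<and> \<delta> \<inter> X \<times> X \<times> X = \<gamma> \<and>
      {z \<in> X. (p, z, q) \<in> \<delta>} = D a"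
    by (rule cyclic_insert_exists[OF \<gamma> X D(1)[OF a(1)]]) (rule D(2)[OF a(1)])
  then obtain \<delta> where \<delta>: "total_cyclic_order_on (insert q X) \<delta>" "\<delta> \<inter> X \<times> X \<times> X = \<gamma>"
    "{z \<in> X. (p, z, q) \<in> \<delta>} = D a"
    by (elim exE conjE)
  show ?thesis
  proof (rule ex1I[of _ \<delta>])
    show "total_cyclic_order_on (insert q X) \<delta> \<and> \<delta> \<inter> X \<times> X \<times> X = \<gamma> \<and>
      (\<exists>a\<in>K. R \<delta> a) \<and> card {z \<in> A. (p, z, q) \<in> \<delta>} = m"
      using \<delta> a R[OF a(1) \<delta>(1,2)] skip[of \<delta>] by auto
  next
    fix \<epsilon>
    assume \<epsilon>: "total_cyclic_order_on (insert q X) \<epsilon> \<and> \<epsilon> \<inter> X \<times> X \<times> X = \<gamma> \<and>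
      (\<exists>a\<in>K. R \<epsilon> a) \<and> card {z \<in> A. (p, z, q) \<in> \<epsilon>} = m"
    then obtain b where b: "b \<in> K" "R \<epsilon> b" by blast
    then have Db: "{z \<in> X. (p, z, q) \<in> \<epsilon>} = D b" using R \<epsilon> by blast
    then have "b = a" using unique[OF b(1)] \<epsilon> skip[of \<epsilon>] by simp
    then show "\<epsilon> = \<delta>"
      using cyclic_insert_unique[of q X \<epsilon> \<delta> p] \<epsilon> \<delta> Db X by simp
  qed
qed

text \<open>The position before \<open>a\<close> passes those elements of \<open>A\<close> that
  precede \<open>a\<close> in a suitable linear order. Their number is the rank of \<open>a\<close>
  within \<open>A\<close>, and every rank below \<open>card A\<close> occurs once.\<close>

lemma ex1_insert_before:
  assumes \<gamma>: "total_cyclic_order_on X \<gamma>" and X: "finite X" "p \<in> X" "q \<notin> X"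
    and A: "A \<subseteq> X" "m < card A"
  shows "\<exists>!\<delta>. total_cyclic_order_on (insert q X) \<delta> \<and> \<delta> \<inter> X \<times> X \<times> X = \<gamma> \<and>
    (\<exists>a\<in>A. immediately_before (insert q X) \<delta> q a) \<and> card {z \<in> A. (p, z, q) \<in> \<delta>} = m"
proof -
  note G = total_cyclic_order_onD[OF \<gamma>]
  let ?r = "base_rank \<gamma> p"
  define D where "D a = (if a = p then X - {p} else {z \<in> X. (p, z, a) \<in> \<gamma>})" for a
  \<comment> \<open>The position right before \<open>p\<close> lies at the end of the circle cut at
    \<open>p\<close>, so here \<open>p\<close> must be the largest element instead of the
    smallest.\<close>
  define u where "u a = (if a = p then Suc (Max (?r ` X)) else ?r a)" for a
  have max: "?r z < Suc (Max (?r ` X))" if "z \<in> X" for z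
    using that X(1) by (simp add: le_imp_less_Suc)
  have inj: "inj_on u X"
    using inj_on_base_rank[OF \<gamma> X(1,2)] max unfolding u_def inj_on_def by (metis less_irrefl)
  have "A \<inter> D a = {z \<in> A. u z < u a}" if "a \<in> A" for a
  proof -
    have "z \<in> D a \<longleftrightarrow> u z < u a" if "z \<in> A" for z
    proof (cases "z = p")
      case True
      have "p \<notin> D a" using G(1) by (auto simp: D_def)
      moreover have "\<not> u p < u a" using max[of a] \<open>a \<in> A\<close> A(1) by (auto simp: u_def)
      ultimately show ?thesis using True by simp
    next
      case False
      then show ?thesis
        using base_rank_less_iff[OF \<gamma> X(1,2), of z a] max[of z] \<open>a \<in> A\<close> that A(1)
        by (auto simp: D_def u_def)
    qed
    then show ?thesis by blast
  qed
  then have "(a \<in> A \<and> card (A \<inter> D a) = m) \<longleftrightarrow> (a \<in> A \<and> card {z \<in> A. u z < u a} = m)" for a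
    by auto
  then have K: "\<exists>!a. a \<in> A \<and> card (A \<inter> D a) = m"
    using ex1_rank[OF finite_subset[OF A(1) X(1)] inj_on_subset[OF inj A(1)] A(2)] by simp
  show ?thesis
  proof (rule cyclic_insert_ex1[OF \<gamma> X K _ _ _ A(1)])
    show "D a \<subseteq> X - {p}" if "a \<in> A" for a using G(1) by (auto simp: D_def)
    show "z \<in> D a" if "a \<in> A" "(p, z, w) \<in> \<gamma>" "w \<in> D a" for a z w
      using that G(1)[of p z w] G(4)[of p z w a] by (auto simp: D_def split: if_splits)
    show "immediately_before (insert q X) \<delta> q a \<longleftrightarrow> {z \<in> X. (p, z, q) \<in> \<delta>} = D a"
      if "a \<in> A" "total_cyclic_order_on (insert q X) \<delta>" "\<delta> \<inter> X \<times> X \<times> X = \<gamma>" for a \<delta>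
    proof -
      have "a \<in> X" using that A(1) by blast
      then have "{z \<in> X. (p, z, a) \<in> \<delta>} = {z \<in> X. (p, z, a) \<in> \<gamma>}" using that(3) X(2) by blast
      then show ?thesis
        unfolding D_def using immediately_before_new_iff(1)[OF that(2) X \<open>a \<in> X\<close>] by simp
    qed
  qed
qed

text \<open>A position after some \<open>a\<close> other than \<open>p\<close> has passed
  \<open>a\<close> itself, so it counts at least one element of \<open>A\<close>. The value 0 is
  attained only right after \<open>p\<close>, which is why \<open>p\<close> is a candidate even when
  it is not in \<open>A\<close>.\<close>

lemma ex1_insert_after:
  assumes \<gamma>: "total_cyclic_order_on X \<gamma>" and X: "finite X" "p \<in> X" "q \<notin> X"
    and A: "A \<subseteq> X" "m < card A"
  shows "\<exists>!\<delta>. total_cyclic_order_on (insert q X) \<delta> \<and> \<delta> \<inter> X \<times> X \<times> X = \<gamma> \<and>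
    (\<exists>a\<in>insert p A. immediately_after (insert q X) \<delta> q a) \<and> card {z \<in> A. (p, z, q) \<in> \<delta>} = m"
proof -
  note G = total_cyclic_order_onD[OF \<gamma>]
  let ?r = "base_rank \<gamma> p"
  let ?B = "insert p A"
  define D where "D a = (if a = p then {} else {z \<in> X. z = a \<or> (p, z, a) \<in> \<gamma>})" for a
  have B: "?B \<subseteq> X" "finite ?B" using A(1) X finite_subset by auto
  have inj: "inj_on ?r ?B"
    using inj_on_base_rank[OF \<gamma> X(1,2)] B(1) by (rule inj_on_subset)
  have card: "card (A \<inter> D a) = card {z \<in> ?B. ?r z < ?r a}" if "a \<in> ?B" for a
  proof (cases "a = p")
    case True
    then show ?thesis by (simp add: D_def base_rank_def)
  next
    case False
    have rp: "?r p = 0" "?r a > 0" using False by (simp_all add: base_rank_def)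
    have "z \<in> D a \<longleftrightarrow> z = a \<or> z \<noteq> p \<and> ?r z < ?r a" if "z \<in> A" for z
    proof (cases "z = p")
      case True
      then show ?thesis using False G(1)[of p p a] by (auto simp: D_def)
    next
      case z: False
      have "z \<in> X" "a \<in> X" using that \<open>a \<in> ?B\<close> B(1) by auto
      then show ?thesis
        using base_rank_less_iff[OF \<gamma> X(1,2), of z a] z False by (simp add: D_def)
    qed
    \<comment> \<open>\<open>D a\<close> contains \<open>a\<close> but not \<open>p\<close>, while
      the set of smaller ranks contains \<open>p\<close> but not \<open>a\<close>; exchanging the
      two keeps the size.\<close>
    then have "A \<inter> D a = insert a {z \<in> A - {p}. ?r z < ?r a}" using that False by blast
    moreover have "{z \<in> ?B. ?r z < ?r a} = insert p {z \<in> A - {p}. ?r z < ?r a}"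
      using rp by auto
    ultimately show ?thesis using B(2) by simp
  qed
  \<comment> \<open>If \<open>p\<close> is not in \<open>A\<close> there is one candidate more than
    needed; its value \<open>card A\<close> lies outside the range of \<open>m\<close>.\<close>
  have "card A \<le> card ?B" by (rule card_mono[OF B(2)]) blast
  then have "m < card ?B" using A(2) by simp
  then have "\<exists>!a. a \<in> ?B \<and> card {z \<in> ?B. ?r z < ?r a} = m"
    by (rule ex1_rank[OF B(2) inj])
  moreover have "a \<in> ?B \<and> card (A \<inter> D a) = m \<longleftrightarrow> a \<in> ?B \<and> card {z \<in> ?B. ?r z < ?r a} = m" for a
    using card[of a] by auto
  ultimately have K: "\<exists>!a. a \<in> ?B \<and> card (A \<inter> D a) = m" by simp
  show ?thesis
  proof (rule cyclic_insert_ex1[OF \<gamma> X K _ _ _ A(1)])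
    show "D a \<subseteq> X - {p}" if "a \<in> ?B" for a using G(1) by (auto simp: D_def)
    show "z \<in> D a" if "a \<in> ?B" "(p, z, w) \<in> \<gamma>" "w \<in> D a" for a z w
      using that G(1)[of p z w] G(4)[of p z w a] by (auto simp: D_def split: if_splits)
    show "immediately_after (insert q X) \<delta> q a \<longleftrightarrow> {z \<in> X. (p, z, q) \<in> \<delta>} = D a"
      if "a \<in> ?B" "total_cyclic_order_on (insert q X) \<delta>" "\<delta> \<inter> X \<times> X \<times> X = \<gamma>" for a \<delta>
    proof -
      have "a \<in> X" using that B(1) by blast
      then have "{z \<in> X. z = a \<or> (p, z, a) \<in> \<delta>} = {z \<in> X. z = a \<or> (p, z, a) \<in> \<gamma>}"
        using that(3) X(2) by blast
      then show ?thesis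
        unfolding D_def using immediately_before_new_iff(2)[OF that(2) X \<open>a \<in> X\<close>] by simp
    qed
  qed
qed

section \<open>Skip vectors of cyclic orders\<close>

lemma ACT_subset: "tail G (y j) < head G (y j) \<Longrightarrow> 1 \<le> j \<Longrightarrow> ACT G y j \<subseteq> {0..<j}"
  by (auto simp: ACT_def active_def) (metis leD nat_less_le)

lemma self_in_INACT: "tail G (y j) < head G (y j) \<Longrightarrow> 1 \<le> j \<Longrightarrow> j \<in> INACT G y j"
  by (simp add: INACT_def active_def)

lemma restrict_order_restrict: "j \<le> m \<Longrightarrow> restrict_order (restrict_order \<gamma> m) j = restrict_order \<gamma> j"
  by (auto simp: restrict_order_def)

lemma restrict_order_id: "total_cyclic_order_on {0..j} \<gamma> \<Longrightarrow> restrict_order \<gamma> j = \<gamma>"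
  unfolding total_cyclic_order_on_def restrict_order_def by (rule inf_absorb1) (elim conjE)

lemma skip_restrict_order:
  assumes "j \<le> m"
  shows "skip G y (restrict_order \<gamma> m) j = skip G y \<gamma> j"
proof -
  have "z \<in> {0..m}" if "z \<in> ACT G y j" for z
    using that assms by (auto simp: ACT_def)
  then have "{z \<in> ACT G y j. (j - 1, z, j) \<in> restrict_order \<gamma> m} = {z \<in> ACT G y j. (j - 1, z, j) \<in> \<gamma>}"
    using assms by (auto simp: restrict_order_def)
  then show ?thesis by (simp add: skip_def)
qed

text \<open>\<open>Q j\<close> stands for the upper or the lower condition at \<open>j\<close>. Like
  \<open>skip j\<close>, it is judged on the restriction to \<open>{0..j}\<close>, so an order with
  prescribed skips is built by inserting one largest element at a time.\<close>

lemma ex1_cyclic_order_skip: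
  assumes ext: "\<And>j \<gamma> m. j \<in> {1..d} \<Longrightarrow> total_cyclic_order_on {0..<j} \<gamma> \<Longrightarrow> m < card (ACT G y j) \<Longrightarrow>
      \<exists>!\<delta>. total_cyclic_order_on {0..j} \<delta> \<and> \<delta> \<inter> {0..<j} \<times> {0..<j} \<times> {0..<j} = \<gamma> \<and>
           Q j \<delta> \<and> skip G y \<delta> j = m"
    and s: "\<And>j. j \<in> {1..d} \<Longrightarrow> s j < card (ACT G y j)"
  shows "\<exists>!\<gamma>. total_cyclic_order_on {0..d} \<gamma> \<and>
    (\<forall>j\<in>{1..d}. Q j (restrict_order \<gamma> j) \<and> skip G y \<gamma> j = s j)"
  using assms
proof (induction d)
  case 0
  have empty: "\<gamma> = {}" if "total_cyclic_order_on {0..0::nat} \<gamma>" for \<gamma>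
  proof (rule equals0I)
    fix t assume "t \<in> \<gamma>"
    then show False using total_cyclic_order_onD(1)[OF that] by (cases t) fastforce
  qed
  have "total_cyclic_order_on {0..0::nat} {}"
    by (simp add: total_cyclic_order_on_def)
  then show ?case using empty by (intro ex1I[of _ "{}"]) auto
next
  case (Suc d)
  define P where "P n \<gamma> \<longleftrightarrow> total_cyclic_order_on {0..n} \<gamma> \<and>
    (\<forall>j\<in>{1..n}. Q j (restrict_order \<gamma> j) \<and> skip G y \<gamma> j = s j)" for n \<gamma>
  have Suc_d: "{0..<Suc d} = {0..d}" by auto
  have restrict: "\<delta> \<inter> {0..<Suc d} \<times> {0..<Suc d} \<times> {0..<Suc d} = restrict_order \<delta> d" for \<delta>
    unfolding Suc_d restrict_order_def ..
  have P_Suc: "P (Suc d) \<delta> \<longleftrightarrow> total_cyclic_order_on {0..Suc d} \<delta> \<and> P d (restrict_order \<delta> d) \<and>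
    Q (Suc d) \<delta> \<and> skip G y \<delta> (Suc d) = s (Suc d)" for \<delta>
  proof (cases "total_cyclic_order_on {0..Suc d} \<delta>")
    case True
    have "total_cyclic_order_on {0..d} (restrict_order \<delta> d)"
      unfolding restrict_order_def using True by (rule total_cyclic_order_on_restrict) simp
    moreover have "{1..Suc d} = insert (Suc d) {1..d}" by auto
    moreover have "restrict_order (restrict_order \<delta> d) j = restrict_order \<delta> j"
      "skip G y (restrict_order \<delta> d) j = skip G y \<delta> j" if "j \<in> {1..d}" for j
      using that by (simp_all add: restrict_order_restrict skip_restrict_order)
    ultimately show ?thesis using True restrict_order_id[OF True] by (auto simp: P_def)
  qed (simp add: P_def)
  have "\<exists>!\<gamma>. P d \<gamma>" unfolding P_def using Suc.prems by (intro Suc.IH) simp_all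
  then obtain \<gamma> where \<gamma>: "P d \<gamma>" and \<gamma>_unique: "\<And>\<gamma>'. P d \<gamma>' \<Longrightarrow> \<gamma>' = \<gamma>" by blast
  have "total_cyclic_order_on {0..<Suc d} \<gamma>" using \<gamma> unfolding Suc_d P_def by blast
  then have "\<exists>!\<delta>. total_cyclic_order_on {0..Suc d} \<delta> \<and> restrict_order \<delta> d = \<gamma> \<and>
      Q (Suc d) \<delta> \<and> skip G y \<delta> (Suc d) = s (Suc d)"
    using Suc.prems(1)[of "Suc d" \<gamma> "s (Suc d)"] Suc.prems(2)[of "Suc d"] unfolding restrict by simp
  then have "\<exists>!\<delta>. P (Suc d) \<delta>"
    unfolding P_Suc using \<gamma> \<gamma>_unique by metis
  then show ?case unfolding P_def .
qed

lemma bij_betw_if_ex1: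
  assumes "\<And>a. a \<in> U \<Longrightarrow> f a \<in> V" "\<And>b. b \<in> V \<Longrightarrow> \<exists>!a. a \<in> U \<and> f a = b"
  shows "bij_betw f U V"
proof -
  have "inj_on f U"
    using assms by (intro inj_onI) metis
  moreover have "V \<subseteq> f ` U"
    using assms(2) by (metis image_eqI subsetI)
  ultimately show ?thesis using assms(1) by (auto simp: bij_betw_def)
qed

text \<open>Extensional functions represent each vector by a single function, so that
  \<open>card\<close> counts vectors.\<close>

definition skip_vectors :: "(nat, 'e) pre_digraph \<Rightarrow> nat \<Rightarrow> (nat \<Rightarrow> 'e) \<Rightarrow> (nat \<Rightarrow> nat) set" where
  "skip_vectors G d y =
     {s \<in> {1..d} \<rightarrow>\<^sub>E UNIV. \<forall>j\<in>{1..d}. (\<Sum>k\<in>INACT G y j. s k) < card (ACT G y j)}"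

text \<open>Being a G-cyclic order is a condition on the skips alone. As \<open>j\<close> is
  inactive at \<open>j\<close>, the condition bounds \<open>s j\<close> by
  \<open>card (ACT j)\<close>, which is what the insertion step requires.\<close>

lemma card_cyclic_orders_eq_card_skip_vectors:
  assumes edge: "\<And>j. j \<in> {1..d} \<Longrightarrow> tail G (y j) < head G (y j)"
    and ext: "\<And>j \<gamma> m. j \<in> {1..d} \<Longrightarrow> total_cyclic_order_on {0..<j} \<gamma> \<Longrightarrow> m < card (ACT G y j) \<Longrightarrow>
      \<exists>!\<delta>. total_cyclic_order_on {0..j} \<delta> \<and> \<delta> \<inter> {0..<j} \<times> {0..<j} \<times> {0..<j} = \<gamma> \<and>
           Q j \<delta> \<and> skip G y \<delta> j = m"
  shows "card {\<gamma>. G_cyclic_order G d y \<gamma> \<and> (\<forall>j\<in>{1..d}. Q j (restrict_order \<gamma> j))} =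
    card (skip_vectors G d y)"
proof (rule bij_betw_same_card)
  let ?U = "{\<gamma>. G_cyclic_order G d y \<gamma> \<and> (\<forall>j\<in>{1..d}. Q j (restrict_order \<gamma> j))}"
  let ?f = "\<lambda>\<gamma>. restrict (skip G y \<gamma>) {1..d}"
  have sum_eq: "(\<Sum>k\<in>INACT G y j. ?f \<gamma> k) = (\<Sum>k\<in>INACT G y j. skip G y \<gamma> k)" if "j \<in> {1..d}" for \<gamma> j
    using that by (intro sum.cong) (auto simp: INACT_def)
  have fU: "?f \<gamma> \<in> skip_vectors G d y" if "\<gamma> \<in> ?U" for \<gamma>
    using that sum_eq by (auto simp: skip_vectors_def G_cyclic_order_def)
  have ex1: "\<exists>!\<gamma>. \<gamma> \<in> ?U \<and> ?f \<gamma> = s" if s: "s \<in> skip_vectors G d y" for s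
  proof -
    have "s j < card (ACT G y j)" if j: "j \<in> {1..d}" for j
    proof -
      have "s j \<le> (\<Sum>k\<in>INACT G y j. s k)"
        using j edge[OF j] by (intro member_le_sum self_in_INACT) (auto simp: INACT_def)
      also have "\<dots> < card (ACT G y j)" using s j by (simp add: skip_vectors_def)
      finally show ?thesis .
    qed
    then have *: "\<exists>!\<gamma>. total_cyclic_order_on {0..d} \<gamma> \<and>
      (\<forall>j\<in>{1..d}. Q j (restrict_order \<gamma> j) \<and> skip G y \<gamma> j = s j)"
      by (intro ex1_cyclic_order_skip ext)
    have f_eq: "?f \<gamma> = s \<longleftrightarrow> (\<forall>j\<in>{1..d}. skip G y \<gamma> j = s j)" for \<gamma>
      using s by (auto simp: skip_vectors_def fun_eq_iff restrict_def PiE_def extensional_def)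
    have "\<gamma> \<in> ?U \<and> ?f \<gamma> = s \<longleftrightarrow> total_cyclic_order_on {0..d} \<gamma> \<and>
      (\<forall>j\<in>{1..d}. Q j (restrict_order \<gamma> j) \<and> skip G y \<gamma> j = s j)" for \<gamma>
    proof -
      have "(\<Sum>k\<in>INACT G y j. skip G y \<gamma> k) < card (ACT G y j)"
        if "\<forall>j\<in>{1..d}. skip G y \<gamma> j = s j" "j \<in> {1..d}" for j
      proof -
        have "(\<Sum>k\<in>INACT G y j. skip G y \<gamma> k) = (\<Sum>k\<in>INACT G y j. s k)"
          using that by (intro sum.cong) (auto simp: INACT_def)
        then show ?thesis using s that(2) by (simp add: skip_vectors_def)
      qed
      then show ?thesis unfolding f_eq G_cyclic_order_def mem_Collect_eq by blast
    qed
    then show ?thesis using * by simp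
  qed
  show "bij_betw ?f ?U (skip_vectors G d y)"
    by (rule bij_betw_if_ex1[OF fU ex1])
qed

text \<open>The insertion lemma is used with base \<open>j - 1\<close>: \<open>skip j\<close> counts
  the active entries passed from there to \<open>j\<close>.\<close>

lemma A_upper_eq_card_skip_vectors:
  assumes edge: "\<And>j. j \<in> {1..d} \<Longrightarrow> tail G (y j) < head G (y j)"
  shows "A_upper G d y = card (skip_vectors G d y)"
  unfolding A_upper_def upper_G_cyclic_order_def
proof (rule card_cyclic_orders_eq_card_skip_vectors[OF edge])
  fix j \<gamma> m
  assume j: "j \<in> {1..d}" and \<gamma>: "total_cyclic_order_on {0..<j} \<gamma>" and m: "m < card (ACT G y j)"
  have "insert j {0..<j} = {0..j}" by auto
  then show "\<exists>!\<delta>. total_cyclic_order_on {0..j} \<delta> \<and> \<delta> \<inter> {0..<j} \<times> {0..<j} \<times> {0..<j} = \<gamma> \<and>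
      (\<exists>k\<in>ACT G y j. immediately_before {0..j} \<delta> j k) \<and> skip G y \<delta> j = m"
    using ex1_insert_before[OF \<gamma> _ _ _ ACT_subset m, of "j - 1" j] edge[OF j] j
    by (simp add: skip_def)
qed

lemma A_lower_eq_card_skip_vectors:
  assumes edge: "\<And>j. j \<in> {1..d} \<Longrightarrow> tail G (y j) < head G (y j)"
  shows "A_lower G d y = card (skip_vectors G d y)"
  unfolding A_lower_def lower_G_cyclic_order_def
proof (rule card_cyclic_orders_eq_card_skip_vectors[OF edge])
  fix j \<gamma> m
  assume j: "j \<in> {1..d}" and \<gamma>: "total_cyclic_order_on {0..<j} \<gamma>" and m: "m < card (ACT G y j)"
  have "insert j {0..<j} = {0..j}" by auto
  then show "\<exists>!\<delta>. total_cyclic_order_on {0..j} \<delta> \<and> \<delta> \<inter> {0..<j} \<times> {0..<j} \<times> {0..<j} = \<gamma> \<and>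
      (immediately_after {0..j} \<delta> j (j - 1) \<or> (\<exists>k\<in>ACT G y j. immediately_after {0..j} \<delta> j k)) \<and>
      skip G y \<delta> j = m"
    using ex1_insert_after[OF \<gamma> _ _ _ ACT_subset m, of "j - 1" j] edge[OF j] j
    by (simp add: skip_def)
qed

section \<open>Volumes of polytopes with interval constraints\<close>

text \<open>The Beta integral over \<open>{0..X}\<close>, by repeated integration by parts that
  moves powers from \<open>t\<close> to \<open>X - t\<close>. It is phrased with an antiderivative
  so that the fundamental theorem applies directly to the nonnegative integral.\<close>

lemma divided_power_product_antiderivative:
  fixes X :: real
  shows "\<exists>F. (\<forall>t. (F has_real_derivative (X - t) ^ a / fact a * (t ^ b / fact b)) (at t)) \<and>
    F X - F 0 = X ^ Suc (a + b) / fact (Suc (a + b))"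
proof -
  have deriv: "((\<lambda>t. (X - t) ^ Suc a / fact (Suc a)) has_real_derivative - ((X - t) ^ a / fact a)) (at t)" for a t
    by (rule DERIV_cong[OF DERIV_cdivide[OF DERIV_power_Suc[OF DERIV_diff[OF DERIV_const DERIV_ident]]]])
      (simp only: fact_Suc of_nat_Suc, auto simp: divide_simps)
  have deriv': "((\<lambda>t. t ^ Suc b / fact (Suc b)) has_real_derivative t ^ b / fact b) (at t)" for b and t :: real
    by (rule DERIV_cong[OF DERIV_cdivide[OF DERIV_power_Suc[OF DERIV_ident]]])
      (simp only: fact_Suc of_nat_Suc, auto simp: divide_simps)
  show ?thesis
  proof (induction b arbitrary: a)
    case 0
    have "((\<lambda>t. - ((X - t) ^ Suc a / fact (Suc a))) has_real_derivative (X - t) ^ a / fact a * (t ^ 0 / fact 0)) (at t)" for t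
      using DERIV_minus[OF deriv[of a t]] by simp
    then show ?case by (intro exI[of _ "\<lambda>t. - ((X - t) ^ Suc a / fact (Suc a))"]) simp
  next
    case (Suc b)
    obtain F where F: "\<And>t. (F has_real_derivative (X - t) ^ Suc a / fact (Suc a) * (t ^ b / fact b)) (at t)"
      "F X - F 0 = X ^ Suc (Suc a + b) / fact (Suc (Suc a + b))"
      using Suc.IH[of "Suc a"] by blast
    \<comment> \<open>The boundary product vanishes at both \<open>t = 0\<close> and
      \<open>t = X\<close>, so it corrects the derivative without changing
      \<open>F X - F 0\<close>.\<close>
    from DERIV_diff[OF F(1) DERIV_mult[OF deriv deriv']]
    have "((\<lambda>t. F t - (X - t) ^ Suc a / fact (Suc a) * (t ^ Suc b / fact (Suc b))) has_real_derivative
        (X - t) ^ a / fact a * (t ^ Suc b / fact (Suc b))) (at t)" for t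
      by (rule DERIV_cong) (simp add: algebra_simps)
    moreover have "Suc (Suc a + b) = Suc (a + Suc b)" by simp
    ultimately show ?case using F(2)
      by (intro exI[of _ "\<lambda>t. F t - (X - t) ^ Suc a / fact (Suc a) * (t ^ Suc b / fact (Suc b))"]) simp
  qed
qed

lemma nn_integral_divided_power_product:
  fixes X :: real
  assumes "0 \<le> X"
  shows "(\<integral>\<^sup>+t. ennreal ((X - t) ^ a / fact a * (t ^ b / fact b)) * indicator {0..X} t \<partial>lborel) =
    ennreal (X ^ Suc (a + b) / fact (Suc (a + b)))"
proof -
  obtain F where F: "\<And>t. (F has_real_derivative (X - t) ^ a / fact a * (t ^ b / fact b)) (at t)"
    "F X - F 0 = X ^ Suc (a + b) / fact (Suc (a + b))"
    using divided_power_product_antiderivative by blast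
  show ?thesis
    unfolding F(2)[symmetric] by (rule nn_integral_FTC_Icc) (use F(1) assms in auto)
qed

text \<open>In divided powers the binomial theorem has no coefficients, so each term of an expansion
  counts once.\<close>

lemma divided_power_add:
  fixes a b :: real
  shows "(a + b) ^ n / fact n = (\<Sum>k\<le>n. a ^ (n - k) / fact (n - k) * (b ^ k / fact k))"
proof -
  have "(a + b) ^ n / fact n = (\<Sum>k\<le>n. of_nat (n choose k) * b ^ k * a ^ (n - k)) / fact n"
    using binomial_ring[of b a n] by (simp add: add.commute[of a b])
  also have "\<dots> = (\<Sum>k\<le>n. a ^ (n - k) / fact (n - k) * (b ^ k / fact k))"
    unfolding sum_divide_distrib
    by (rule sum.cong) (simp_all add: binomial_fact field_simps)
  finally show ?thesis .
qed

lemma measurable_coordinate: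
  "k \<in> I \<Longrightarrow> (\<lambda>u. u k) \<in> borel_measurable (Pi\<^sub>M I (\<lambda>_. lborel :: real measure))"
  using measurable_component_singleton[of k I "\<lambda>_. lborel :: real measure"] by simp

lemma measurable_coordinate_sum:
  "B \<subseteq> I \<Longrightarrow> (\<lambda>u. sum u B) \<in> borel_measurable (Pi\<^sub>M I (\<lambda>_. lborel :: real measure))"
  by (intro borel_measurable_sum measurable_coordinate) auto

text \<open>\<open>S j\<close> abstracts \<open>INACT j\<close>. By \<open>S_Suc\<close> a variable
  that has left never returns, so each one is present on an interval of indices. The empty sets
  beyond \<open>d\<close> let the final closings at \<open>j = d\<close> follow the same rule as all
  others.\<close>

locale interval_constraints =
  fixes S :: "nat \<Rightarrow> nat set" and d :: nat
  assumes S_subset: "S j \<subseteq> {1..j}"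
    and S_self: "j \<in> {1..d} \<Longrightarrow> j \<in> S j"
    and S_beyond: "d < j \<Longrightarrow> S j = {}"
    and S_Suc: "S (Suc j) \<subseteq> insert (Suc j) (S j)"
begin

text \<open>Used contrapositively: an open variable missing from \<open>S (Suc j)\<close> occurs in
  no later constraint and may be integrated out.\<close>

lemma S_stays_closed:
  assumes "j < i" "k \<in> S i" "k \<le> j"
  shows "k \<in> S (Suc j)"
  using assms
proof (induction i)
  case (Suc i)
  then show ?case using S_Suc[of i] by (cases "i = j") auto
qed simp

lemma finite_S: "finite (S j)"
  using S_subset by (rule finite_subset) simp

text \<open>
  A state \<open>(j, A, s)\<close> means that the variables up to \<open>j\<close> have been opened, those in
  \<open>A\<close> are not yet integrated out, and \<open>s\<close> gives their exponents; \<open>slack_exponent\<close> is the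
  exponent of the slack variable \<open>1 - sum u A\<close>.
\<close>

definition slack_exponent :: "nat \<Rightarrow> nat set \<Rightarrow> (nat \<Rightarrow> nat) \<Rightarrow> nat" where
  "slack_exponent j A s = j - card A - sum s A"

text \<open>The exponents add up to \<open>j - card A\<close>, the number of variables already
  integrated out; this is the origin of \<open>slack_exponent\<close>, whose subtraction is exact as
  long as \<open>card A + sum s A \<le> j\<close>.\<close>

definition weight :: "nat \<Rightarrow> nat set \<Rightarrow> (nat \<Rightarrow> nat) \<Rightarrow> (nat \<Rightarrow> real) \<Rightarrow> real" where
  "weight j A s u = (1 - sum u A) ^ slack_exponent j A s / fact (slack_exponent j A s) *
     (\<Prod>k\<in>A. u k ^ s k / fact (s k))"

text \<open>Between two openings \<open>A\<close> need not be any of the sets \<open>S i\<close>, so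
  nonnegativity of the slack variable is demanded separately from the pending constraints.\<close>

definition feasible :: "nat \<Rightarrow> nat set \<Rightarrow> (nat \<Rightarrow> real) \<Rightarrow> bool" where
  "feasible j A u \<longleftrightarrow> (\<forall>k\<in>A \<union> {j<..d}. 0 \<le> u k) \<and> sum u A \<le> 1 \<and> (\<forall>i\<in>{j<..d}. sum u (S i) \<le> 1)"

definition weighted_volume :: "nat \<Rightarrow> nat set \<Rightarrow> (nat \<Rightarrow> nat) \<Rightarrow> ennreal" where
  "weighted_volume j A s = (\<integral>\<^sup>+u. ennreal (weight j A s u) * indicator {u. feasible j A u} u
     \<partial>Pi\<^sub>M (A \<union> {j<..d}) (\<lambda>_. lborel))"

text \<open>The inequality at \<open>i\<close> says that the exponents fit into the total degree
  available when \<open>i\<close> has just been opened and the open set is \<open>S i\<close>, that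
  is, the slack exponent is a true nonnegative difference.\<close>

definition completions :: "nat \<Rightarrow> (nat \<Rightarrow> nat) \<Rightarrow> (nat \<Rightarrow> nat) set" where
  "completions j s = {t \<in> {1..d} \<rightarrow>\<^sub>E UNIV. (\<forall>k\<in>{1..j}. t k = s k) \<and>
     (\<forall>i\<in>{j<..d}. sum t (S i) \<le> i - card (S i))}"

lemma finite_completions:
  assumes "j \<le> d"
  shows "finite (completions j s)"
proof (rule finite_subset)
  show "finite ({1..d} \<rightarrow>\<^sub>E {..Max (s ` {1..d}) + d})"
    by (intro finite_PiE) simp_all
  show "completions j s \<subseteq> {1..d} \<rightarrow>\<^sub>E {..Max (s ` {1..d}) + d}"
  proof
    fix t assume t: "t \<in> completions j s"
    have "t k \<le> Max (s ` {1..d}) + d" if k: "k \<in> {1..d}" for k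
    proof (cases "k \<le> j")
      case True
      then have "t k = s k" using t k by (auto simp: completions_def)
      then show ?thesis using k by (intro trans_le_add1) simp
    next
      case False
      have "t k \<le> sum t (S k)" using k by (intro member_le_sum S_self finite_S) simp_all
      also have "\<dots> \<le> k - card (S k)" using t k False by (auto simp: completions_def)
      also have "\<dots> \<le> d" using k by (auto intro: le_trans[OF diff_le_self])
      finally show ?thesis by simp
    qed
    then show "t \<in> {1..d} \<rightarrow>\<^sub>E {..Max (s ` {1..d}) + d}"
      using t by (auto simp: completions_def PiE_iff)
  qed
qed

text \<open>Ensures that the pending constraints read only coordinates that the current product
  space still has.\<close>

lemma S_subset_state:
  assumes "S (Suc j) \<subseteq> insert (Suc j) A" "i \<in> {j<..d}"
  shows "S i \<subseteq> A \<union> {j<..d}"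
proof
  fix k assume k: "k \<in> S i"
  then have "k \<le> i" using S_subset[of i] by auto
  then show "k \<in> A \<union> {j<..d}"
    using S_stays_closed[of j i k] k assms by (cases "k \<le> j") auto
qed

lemma sets_feasible:
  assumes "S (Suc j) \<subseteq> insert (Suc j) A" "finite A"
  shows "{u \<in> space (Pi\<^sub>M (A \<union> {j<..d}) (\<lambda>_. lborel)). feasible j A u} \<in> sets (Pi\<^sub>M (A \<union> {j<..d}) (\<lambda>_. lborel))"
  unfolding feasible_def
proof (intro sets.sets_Collect_conj sets.sets_Collect_finite_All)
  let ?M = "Pi\<^sub>M (A \<union> {j<..d}) (\<lambda>_. lborel :: real measure)"
  note [measurable] = measurable_coordinate_sum
  show "{u \<in> space ?M. 0 \<le> u k} \<in> sets ?M" if "k \<in> A \<union> {j<..d}" for k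
    using measurable_coordinate[OF that] by measurable
  show "{u \<in> space ?M. sum u A \<le> 1} \<in> sets ?M" by measurable
  show "{u \<in> space ?M. sum u (S i) \<le> 1} \<in> sets ?M" if "i \<in> {j<..d}" for i
    using S_subset_state[OF assms(1) that] by measurable
qed (use assms in auto)

lemma measurable_weighted_indicator:
  assumes "S (Suc j) \<subseteq> insert (Suc j) A" "finite A"
  shows "(\<lambda>u. ennreal (weight j A s u) * indicator {u. feasible j A u} u)
    \<in> borel_measurable (Pi\<^sub>M (A \<union> {j<..d}) (\<lambda>_. lborel))"
proof -
  let ?M = "Pi\<^sub>M (A \<union> {j<..d}) (\<lambda>_. lborel :: real measure)"
  have "weight j A s \<in> borel_measurable ?M"
    unfolding weight_def
    by (intro borel_measurable_times borel_measurable_divide borel_measurable_power borel_measurable_diff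
        borel_measurable_const borel_measurable_prod measurable_coordinate measurable_coordinate_sum) auto
  moreover have "(indicator {u \<in> space ?M. feasible j A u} :: _ \<Rightarrow> ennreal) \<in> borel_measurable ?M"
    using sets_feasible[OF assms] by (rule borel_measurable_indicator)
  then have "(indicator {u. feasible j A u} :: _ \<Rightarrow> ennreal) \<in> borel_measurable ?M"
    by (rule measurable_cong[THEN iffD1, rotated]) (simp add: indicator_def)
  ultimately show ?thesis by measurable
qed

text \<open>By Fubini the variable \<open>u k\<close> is integrated first. It is absent from all
  pending constraints, so it ranges over \<open>{0..X}\<close> with \<open>X\<close> the slack left
  by the other open variables, and the Beta integral merges its divided power with that of the
  slack.\<close>

lemma weighted_volume_close:
  assumes j: "j \<le> d" and A: "A \<subseteq> {1..j}" "S (Suc j) \<subseteq> insert (Suc j) A"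
    and s: "card A + sum s A \<le> j" and k: "k \<in> A" "k \<notin> S (Suc j)"
  shows "weighted_volume j A s = weighted_volume j (A - {k}) s"
proof -
  let ?B = "A - {k}"
  let ?I = "?B \<union> {j<..d}"
  interpret product_sigma_finite "\<lambda>_::nat. lborel :: real measure" by standard
  have fin: "finite A" using A(1) finite_subset by blast
  have kI: "k \<notin> ?I" "A \<union> {j<..d} = insert k ?I" using k A(1) by auto
  have sumA: "sum f A = f k + sum f ?B" for f :: "nat \<Rightarrow> 'b::comm_monoid_add"
    using fin k(1) by (rule sum.remove)
  have cardA: "card A = Suc (card ?B)" by (rule card_Suc_Diff1[OF fin k(1), symmetric])
  \<comment> \<open>The extra one in the Beta integral matches the drop of
    \<open>card A\<close>.\<close>
  have exponent: "slack_exponent j ?B s = Suc (slack_exponent j A s + s k)"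
    using s cardA sumA[of s] by (simp add: slack_exponent_def)
  have S: "k \<notin> S i" if "i \<in> {j<..d}" for i
    using S_stays_closed[of j i k] k A(1) that by auto
  have inner: "(\<integral>\<^sup>+x. ennreal (weight j A s (u(k := x))) * indicator {u. feasible j A u} (u(k := x)) \<partial>lborel) =
      ennreal (weight j ?B s u) * indicator {u. feasible j ?B u} u" for u
  proof -
    let ?X = "1 - sum u ?B" and ?c = "slack_exponent j A s" and ?P = "\<Prod>i\<in>?B. u i ^ s i / fact (s i)"
    have sumB: "sum (u(k := x)) ?B = sum u ?B" for x by (intro sum.cong) auto
    have sumS: "sum (u(k := x)) (S i) = sum u (S i)" if "i \<in> {j<..d}" for x i
      using S[OF that] by (intro sum.cong) auto
    have prodB: "(\<Prod>i\<in>?B. (u(k := x)) i ^ s i / fact (s i)) = ?P" for x by (intro prod.cong) auto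
    have w: "weight j A s (u(k := x)) = ?P * ((?X - x) ^ ?c / fact ?c * (x ^ s k / fact (s k)))" for x
      unfolding weight_def sumA[of "u(k := x)"] sumB prod.remove[OF fin k(1)] prodB
      by (simp add: diff_diff_eq add.commute)
    have f: "feasible j A (u(k := x)) \<longleftrightarrow> feasible j ?B u \<and> 0 \<le> x \<and> x \<le> ?X" for x
    proof -
      have "(\<forall>i\<in>A \<union> {j<..d}. 0 \<le> (u(k := x)) i) \<longleftrightarrow> 0 \<le> x \<and> (\<forall>i\<in>?I. 0 \<le> u i)"
      proof -
        have "(u(k := x)) i = u i" if "i \<in> ?I" for i using kI(1) that by (metis fun_upd_other)
        then have "(\<forall>i\<in>?I. 0 \<le> (u(k := x)) i) \<longleftrightarrow> (\<forall>i\<in>?I. 0 \<le> u i)" by (metis (lifting))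
        then show ?thesis unfolding kI(2) ball_simps(7) fun_upd_same by (rule conj_cong[OF refl])
      qed
      moreover have "sum (u(k := x)) A \<le> 1 \<longleftrightarrow> x \<le> ?X"
        unfolding sumA[of "u(k := x)"] sumB by auto
      moreover have "(\<forall>i\<in>{j<..d}. sum (u(k := x)) (S i) \<le> 1) \<longleftrightarrow> (\<forall>i\<in>{j<..d}. sum u (S i) \<le> 1)"
        using sumS by simp
      ultimately show ?thesis unfolding feasible_def by auto
    qed
    show ?thesis
    proof (cases "feasible j ?B u")
      case True
      have P: "0 \<le> ?P" using True by (intro prod_nonneg) (auto simp: feasible_def)
      have X: "0 \<le> ?X" using True by (simp add: feasible_def)
      have "(\<integral>\<^sup>+x. ennreal (weight j A s (u(k := x))) * indicator {u. feasible j A u} (u(k := x)) \<partial>lborel) =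
        (\<integral>\<^sup>+x. ennreal ?P * (ennreal ((?X - x) ^ ?c / fact ?c * (x ^ s k / fact (s k))) * indicator {0..?X} x) \<partial>lborel)"
      proof (rule nn_integral_cong)
        fix x
        have "indicator {u. feasible j A u} (u(k := x)) = (indicator {0..?X} x :: ennreal)"
          unfolding indicator_def mem_Collect_eq f by (simp add: True)
        then show "ennreal (weight j A s (u(k := x))) * indicator {u. feasible j A u} (u(k := x)) =
          ennreal ?P * (ennreal ((?X - x) ^ ?c / fact ?c * (x ^ s k / fact (s k))) * indicator {0..?X} x)"
          unfolding w ennreal_mult'[OF P] by (simp only: mult.assoc)
      qed
      also have "\<dots> = ennreal ?P * ennreal (?X ^ Suc (?c + s k) / fact (Suc (?c + s k)))"
        unfolding nn_integral_divided_power_product[OF X, symmetric] by (rule nn_integral_cmult) measurable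
      also have "\<dots> = ennreal (weight j ?B s u)"
        unfolding weight_def exponent ennreal_mult'[OF P, symmetric] by (simp only: mult.commute)
      finally show ?thesis using True by simp
    qed (simp add: f)
  qed
  have "weighted_volume j A s = (\<integral>\<^sup>+u. (\<integral>\<^sup>+x. ennreal (weight j A s (u(k := x))) *
      indicator {u. feasible j A u} (u(k := x)) \<partial>lborel) \<partial>Pi\<^sub>M ?I (\<lambda>_. lborel))"
    unfolding weighted_volume_def kI(2)
    by (rule product_nn_integral_insert)
      (use fin kI measurable_weighted_indicator[OF A(2) fin, of s] in simp_all)
  then show ?thesis unfolding inner weighted_volume_def .
qed

text \<open>Nothing is integrated: the old slack is the new slack plus \<open>u (Suc j)\<close>, and
  the integrand is expanded pointwise. The index \<open>b\<close> is the exponent that goes to the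
  new variable.\<close>

lemma weighted_volume_open:
  assumes j: "j < d" and A: "A \<subseteq> {1..j}" "S (Suc j) = insert (Suc j) A"
    and s: "card A + sum s A \<le> j"
  shows "weighted_volume j A s =
    (\<Sum>b\<le>slack_exponent j A s. weighted_volume (Suc j) (insert (Suc j) A) (s(Suc j := b)))"
proof -
  let ?k = "Suc j" and ?B = "insert (Suc j) A" and ?c = "slack_exponent j A s"
  have fin: "finite A" using A(1) finite_subset by blast
  have k: "?k \<notin> A" using A(1) by auto
  have I: "A \<union> {j<..d} = ?B \<union> {?k<..d}" using j by auto
  have exponent: "slack_exponent ?k ?B (s(?k := b)) = ?c - b" if "b \<le> ?c" for b
  proof -
    have "sum (s(?k := b)) A = sum s A" using k by (intro sum.cong) auto
    then show ?thesis using fin k by (simp add: slack_exponent_def)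
  qed
  have eq: "ennreal (weight j A s u) * indicator {u. feasible j A u} u =
    (\<Sum>b\<le>?c. ennreal (weight ?k ?B (s(?k := b)) u) * indicator {u. feasible ?k ?B u} u)" for u
  proof -
    have sumB: "sum u ?B = u ?k + sum u A" using fin k by simp
    \<comment> \<open>The pending constraint at \<open>Suc j\<close> becomes the new slack
      condition. It implies the old one because \<open>u (Suc j)\<close> is nonnegative.\<close>
    have f: "feasible j A u \<longleftrightarrow> feasible ?k ?B u"
    proof -
      have "{j<..d} = insert ?k {?k<..d}" using j by auto
      then show ?thesis
        unfolding feasible_def I using A(2) sumB by (auto simp: I)
    qed
    show ?thesis
    proof (cases "feasible ?k ?B u")
      case True
      let ?X = "1 - sum u ?B" and ?P = "\<Prod>i\<in>A. u i ^ s i / fact (s i)"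
      have w: "weight ?k ?B (s(?k := b)) u = ?X ^ (?c - b) / fact (?c - b) * (u ?k ^ b / fact b) * ?P"
        if "b \<le> ?c" for b
      proof -
        have "(\<Prod>i\<in>A. u i ^ (s(?k := b)) i / fact ((s(?k := b)) i)) = ?P"
          using k by (intro prod.cong) auto
        then show ?thesis
          unfolding weight_def exponent[OF that] using fin k by (simp add: mult.assoc)
      qed
      have pos: "0 \<le> weight ?k ?B (s(?k := b)) u" for b
        unfolding weight_def using True
        by (intro mult_nonneg_nonneg prod_nonneg divide_nonneg_nonneg zero_le_power) (auto simp: feasible_def)
      have "weight j A s u = (?X + u ?k) ^ ?c / fact ?c * ?P"
        unfolding weight_def sumB by simp
      also have "\<dots> = (\<Sum>b\<le>?c. weight ?k ?B (s(?k := b)) u)"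
        unfolding divided_power_add sum_distrib_right using w by (intro sum.cong) simp_all
      finally have "ennreal (weight j A s u) = (\<Sum>b\<le>?c. ennreal (weight ?k ?B (s(?k := b)) u))"
        using pos by simp
      then show ?thesis using f True by simp
    qed (simp add: f)
  qed
  have S: "S (Suc ?k) \<subseteq> insert (Suc ?k) ?B" using S_Suc[of ?k] A(2) by simp
  show ?thesis
    unfolding weighted_volume_def eq I
    by (rule nn_integral_sum) (rule measurable_weighted_indicator[OF S], use fin in simp)
qed

text \<open>Mirrors the analytic expansion: completions are sorted by their value \<open>b\<close>
  at \<open>Suc j\<close>, where the inequality says precisely that \<open>b\<close> is at most the
  slack exponent.\<close>

lemma card_completions_open:
  assumes j: "j < d" and A: "A \<subseteq> {1..j}" "S (Suc j) = insert (Suc j) A"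
    and s: "card A + sum s A \<le> j"
  shows "card (completions j s) =
    (\<Sum>b\<le>slack_exponent j A s. card (completions (Suc j) (s(Suc j := b))))"
proof -
  let ?k = "Suc j" and ?c = "slack_exponent j A s"
  have fin: "finite A" using A(1) finite_subset by blast
  have k: "?k \<notin> A" using A(1) by auto
  have mem: "t \<in> completions ?k (s(?k := b)) \<longleftrightarrow> t \<in> completions j s \<and> t ?k = b" if "b \<le> ?c" for b t
  proof -
    have 1: "{j<..d} = insert ?k {?k<..d}" "{1..?k} = insert ?k {1..j}" using j by auto
    have "sum t (S ?k) \<le> ?k - card (S ?k)" if "\<forall>i\<in>{1..j}. t i = s i" "t ?k = b"
    proof -
      have "sum t A = sum s A" using that(1) A(1) by (intro sum.cong) auto
      then show ?thesis using that(2) \<open>b \<le> ?c\<close> fin k s unfolding A(2) slack_exponent_def by simp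
    qed
    then show ?thesis unfolding completions_def 1 by auto
  qed
  have le: "t ?k \<le> ?c" if t: "t \<in> completions j s" for t
  proof -
    have "sum t A = sum s A" using t A(1) by (intro sum.cong) (auto simp: completions_def)
    moreover have "sum t (S ?k) \<le> ?k - card (S ?k)" using t j by (simp add: completions_def)
    ultimately show ?thesis using fin k unfolding A(2) slack_exponent_def by simp
  qed
  have "completions j s = (\<Union>b\<in>{..?c}. completions ?k (s(?k := b)))"
    using mem le by auto
  also have "card \<dots> = (\<Sum>b\<le>?c. card (completions ?k (s(?k := b))))"
    using j mem by (intro card_UN_disjoint ballI impI finite_completions) auto
  finally show ?thesis .
qed

lemma weighted_volume_eq:
  assumes "j \<le> d" "A \<subseteq> {1..j}" "S (Suc j) \<subseteq> insert (Suc j) A" "card A + sum s A \<le> j"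
  shows "weighted_volume j A s = of_nat (card (completions j s)) * ennreal (1 / fact d)"
  using assms
\<comment> \<open>Closing lowers \<open>card A\<close> by one; opening raises it by one but lowers
  \<open>d - j\<close>, hence the factor 2. Closings come first: only when none is possible does
  \<open>S (Suc j)\<close> equal \<open>insert (Suc j) A\<close>.\<close>
proof (induction "2 * (d - j) + card A" arbitrary: j A s rule: less_induct)
  case less
  have fin: "finite A" using less.prems(2) finite_subset by blast
  consider k where "k \<in> A" "k \<notin> S (Suc j)" | "A \<subseteq> S (Suc j)" "j < d" | "A \<subseteq> S (Suc j)" "j = d"
    using less.prems(1) by force
  then show ?case
  proof cases
    case (1 k)
    have c: "card (A - {k}) < card A" using fin 1(1) by (rule card_Diff1_less)
    have "sum s (A - {k}) \<le> sum s A" using fin by (intro sum_mono2) auto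
    then have "weighted_volume j (A - {k}) s = of_nat (card (completions j s)) * ennreal (1 / fact d)"
      using less.prems 1 c by (intro less.hyps) auto
    then show ?thesis using weighted_volume_close[OF less.prems 1] by simp
  next
    case 2
    let ?B = "insert (Suc j) A"
    have S: "S (Suc j) = ?B" using 2 less.prems(3) S_self[of "Suc j"] by auto
    have k: "Suc j \<notin> A" using less.prems(2) by auto
    have "weighted_volume (Suc j) ?B (s(Suc j := b)) =
        of_nat (card (completions (Suc j) (s(Suc j := b)))) * ennreal (1 / fact d)"
      if b: "b \<le> slack_exponent j A s" for b
    proof (rule less.hyps)
      show "2 * (d - Suc j) + card ?B < 2 * (d - j) + card A" using 2 fin k by simp
      show "Suc j \<le> d" "?B \<subseteq> {1..Suc j}" using 2 less.prems(2) by auto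
      show "S (Suc (Suc j)) \<subseteq> insert (Suc (Suc j)) ?B" using S_Suc[of "Suc j"] S by simp
      have "sum (s(Suc j := b)) A = sum s A" using k by (intro sum.cong) auto
      then show "card ?B + sum (s(Suc j := b)) ?B \<le> Suc j"
        using b fin k less.prems(4) by (simp add: slack_exponent_def)
    qed
    then show ?thesis
      unfolding weighted_volume_open[OF 2(2) less.prems(2) S less.prems(4)]
        card_completions_open[OF 2(2) less.prems(2) S less.prems(4)]
      by (simp add: sum_distrib_right)
  next
    case 3
    \<comment> \<open>The final state: the slack is 1 with exponent \<open>d\<close>, which gives
      \<open>1 / fact d\<close>, and the exponents are completely prescribed, which leaves one
      completion.\<close>
    have A: "A = {}" using 3 S_beyond[of "Suc d"] by simp
    have "completions d s = {restrict s {1..d}}"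
      unfolding completions_def by (auto simp: PiE_iff extensional_def restrict_def)
    moreover have "weighted_volume d {} s = ennreal (1 / fact d)"
      unfolding weighted_volume_def
      by (simp add: PiM_empty nn_integral_count_space_finite weight_def slack_exponent_def feasible_def)
    ultimately show ?thesis using 3 A by simp
  qed
qed

text \<open>The initial state, where no variable is open, has constant weight 1, so its weighted
  volume is the plain volume.\<close>

lemma emeasure_constraint_polytope:
  "emeasure (Pi\<^sub>M {1..d} (\<lambda>_. lborel))
     {u \<in> {1..d} \<rightarrow>\<^sub>E UNIV. (\<forall>k\<in>{1..d}. 0 \<le> u k) \<and> (\<forall>i\<in>{1..d}. sum u (S i) \<le> (1 :: real))} =
   of_nat (card {t \<in> {1..d} \<rightarrow>\<^sub>E UNIV. \<forall>i\<in>{1..d}. sum t (S i) \<le> i - card (S i)}) * ennreal (1 / fact d)"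
proof -
  let ?M = "Pi\<^sub>M {1..d} (\<lambda>_. lborel :: real measure)"
  let ?P = "{u \<in> {1..d} \<rightarrow>\<^sub>E UNIV. (\<forall>k\<in>{1..d}. 0 \<le> u k) \<and> (\<forall>i\<in>{1..d}. sum u (S i) \<le> (1 :: real))}"
  have I: "{0<..d} = {1..d}" by auto
  have S: "S (Suc 0) \<subseteq> insert (Suc 0) {}" using S_subset[of "Suc 0"] by auto
  have P: "?P = {u \<in> space ?M. feasible 0 {} u}" by (auto simp: feasible_def space_PiM I)
  have eq: "ennreal (weight 0 {} s u) * indicator {u. feasible 0 {} u} u = indicator ?P u"
    if "u \<in> space ?M" for u s
    unfolding P using that by (simp add: weight_def slack_exponent_def indicator_def)
  have "?P \<in> sets ?M"
    unfolding P by (rule sets_feasible[OF S finite.emptyI, unfolded Un_empty_left I])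
  then have "emeasure ?M ?P = (\<integral>\<^sup>+u. indicator ?P u \<partial>?M)" by simp
  also have "\<dots> = weighted_volume 0 {} (\<lambda>_. 0)"
    unfolding weighted_volume_def Un_empty_left I by (rule nn_integral_cong) (rule eq[symmetric])
  also have "\<dots> = of_nat (card (completions 0 (\<lambda>_. 0))) * ennreal (1 / fact d)"
    by (rule weighted_volume_eq) (use S in auto)
  finally show ?thesis by (simp add: completions_def I)
qed

end

section \<open>Lattice-normalized volume\<close>

text \<open>Haar measure on the subspace \<open>W\<close>, kept as a measure on the ambient space
  that is concentrated on \<open>W\<close>; measures coming from different bases can then be
  compared as equals of one type.\<close>

locale translation_invariant = sigma_finite_measure \<mu> for \<mu> :: "'a::euclidean_space measure" +
  fixes W :: "'a set"
  assumes sets_eq [measurable_cong, simp]: "sets \<mu> = sets borel"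
    and subspace_W: "subspace W"
    and AE_W: "AE x in \<mu>. x \<in> W"
    and distr_translate: "w \<in> W \<Longrightarrow> distr \<mu> borel (\<lambda>x. x + w) = \<mu>"
begin

lemma space_eq [simp]: "space \<mu> = UNIV"
  using sets_eq_imp_space_eq[OF sets_eq] by simp

lemma nn_integral_translate:
  assumes "w \<in> W" and [measurable]: "f \<in> borel_measurable borel"
  shows "(\<integral>\<^sup>+x. f (x + w) \<partial>\<mu>) = (\<integral>\<^sup>+x. f x \<partial>\<mu>)"
proof -
  have "(\<integral>\<^sup>+x. f x \<partial>\<mu>) = (\<integral>\<^sup>+x. f x \<partial>distr \<mu> borel (\<lambda>x. x + w))"
    using distr_translate[OF assms(1)] by simp
  also have "\<dots> = (\<integral>\<^sup>+x. f (x + w) \<partial>\<mu>)"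
    by (rule nn_integral_distr) measurable
  finally show ?thesis by simp
qed

lemma emeasure_translate:
  assumes "w \<in> W" "A \<in> sets borel"
  shows "emeasure \<mu> {x. x + w \<in> A} = emeasure \<mu> A"
proof -
  have "emeasure \<mu> A = emeasure (distr \<mu> borel (\<lambda>x. x + w)) A"
    using distr_translate[OF assms(1)] by simp
  also have "\<dots> = emeasure \<mu> {x. x + w \<in> A}"
    using assms(2) by (subst emeasure_distr) (simp_all add: vimage_def)
  finally show ?thesis by simp
qed

text \<open>Two fundamental domains are equidecomposable by translations from \<open>\<Lambda>\<close>.\<close>

lemma emeasure_fundamental_domains:
  assumes \<Lambda>: "countable \<Lambda>" "\<Lambda> \<subseteq> W" "\<And>z. z \<in> \<Lambda> \<Longrightarrow> - z \<in> \<Lambda>"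
    and D: "D \<in> sets borel" "D \<subseteq> W" "\<And>w. w \<in> W \<Longrightarrow> \<exists>!z. z \<in> \<Lambda> \<and> w + z \<in> D"
    and E: "E \<in> sets borel" "E \<subseteq> W" "\<And>w. w \<in> W \<Longrightarrow> \<exists>!z. z \<in> \<Lambda> \<and> w + z \<in> E"
  shows "emeasure \<mu> D = emeasure \<mu> E"
proof -
  note [measurable] = D(1) E(1)
  have D_eq: "D = (\<Union>z\<in>\<Lambda>. {x \<in> D. x + z \<in> E})"
    using D(2) E(3) by blast
  have E_eq: "E = (\<Union>z\<in>\<Lambda>. {x \<in> E. x - z \<in> D})"
  proof -
    have "\<exists>z\<in>\<Lambda>. x - z \<in> D" if x: "x \<in> E" for x
    proof -
      obtain z where "z \<in> \<Lambda>" "x + z \<in> D" using D(3)[of x] E(2) x by blast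
      then show ?thesis using \<Lambda>(3)[of z] by (intro bexI[of _ "- z"]) simp_all
    qed
    then show ?thesis by blast
  qed
  have "emeasure \<mu> (\<Union>z\<in>\<Lambda>. {x \<in> D. x + z \<in> E}) = (\<integral>\<^sup>+z. emeasure \<mu> {x \<in> D. x + z \<in> E} \<partial>count_space \<Lambda>)"
  proof (rule emeasure_UN_countable[OF _ \<Lambda>(1)])
    show "disjoint_family_on (\<lambda>z. {x \<in> D. x + z \<in> E}) \<Lambda>"
      unfolding disjoint_family_on_def using D(2) E(3) by blast
  qed simp
  moreover have "emeasure \<mu> (\<Union>z\<in>\<Lambda>. {x \<in> E. x - z \<in> D}) = (\<integral>\<^sup>+z. emeasure \<mu> {x \<in> E. x - z \<in> D} \<partial>count_space \<Lambda>)"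
  proof (rule emeasure_UN_countable[OF _ \<Lambda>(1)])
    have "z = z'" if "z \<in> \<Lambda>" "z' \<in> \<Lambda>" "x \<in> E" "x - z \<in> D" "x - z' \<in> D" for x z z'
    proof -
      have "x \<in> W" "x + - z \<in> D" "x + - z' \<in> D" using that E(2) by auto
      then have "- z = - z'" using D(3)[of x] \<Lambda>(3) that(1,2) by blast
      then show ?thesis by simp
    qed
    then show "disjoint_family_on (\<lambda>z. {x \<in> E. x - z \<in> D}) \<Lambda>"
      unfolding disjoint_family_on_def by blast
  qed simp
  moreover have "emeasure \<mu> {x \<in> D. x + z \<in> E} = emeasure \<mu> {x \<in> E. x - z \<in> D}" if "z \<in> \<Lambda>" for z
  proof -
    have "{x. x + z \<in> {x \<in> E. x - z \<in> D}} = {x \<in> D. x + z \<in> E}" by auto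
    moreover have "{x \<in> E. x - z \<in> D} \<in> sets borel" by measurable
    ultimately show ?thesis using emeasure_translate[of z "{x \<in> E. x - z \<in> D}"] that \<Lambda>(2) by auto
  qed
  ultimately show ?thesis
    using D_eq E_eq by (metis (no_types, lifting) nn_integral_cong space_count_space)
qed

end

text \<open>
  The uniqueness argument for Haar measure: both sides are the double integral of
  \<open>(x, y) \<mapsto> 1\<^bsub>A\<^esub> (x + y) * 1\<^bsub>E\<^esub> y\<close>.
\<close>

lemma translation_invariant_proportional:
  assumes "translation_invariant \<mu> W" "translation_invariant \<nu> W"
    and [measurable]: "A \<in> sets borel" "E \<in> sets borel"
  shows "emeasure \<mu> A * emeasure \<nu> E = emeasure \<nu> A * emeasure \<mu> (uminus ` E)"
proof -
  interpret \<mu>: translation_invariant \<mu> W by fact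
  interpret \<nu>: translation_invariant \<nu> W by fact
  interpret pair_sigma_finite \<mu> \<nu> ..
  let ?A = "indicator A :: _ \<Rightarrow> ennreal" and ?E = "indicator E :: _ \<Rightarrow> ennreal"
  \<comment> \<open>Integrating over \<open>x\<close> turns \<open>E\<close> into its reflection;
    the shift by \<open>y\<close> is absorbed because \<open>y\<close> lies in
    \<open>W\<close>.\<close>
  have minus: "(\<integral>\<^sup>+x. ?E (y - x) \<partial>\<mu>) = emeasure \<mu> (uminus ` E)" if "y \<in> W" for y
  proof -
    have E': "uminus ` E = {x. - x \<in> E}" by (auto intro: image_eqI[of _ uminus "- x" for x])
    have [measurable]: "uminus ` E \<in> sets borel" unfolding E' by measurable
    have "- y \<in> W" using that \<mu>.subspace_W by (rule subspace_neg[rotated])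
    then have "emeasure \<mu> (uminus ` E) = emeasure \<mu> {x. x + - y \<in> uminus ` E}"
      using \<mu>.emeasure_translate[of "- y" "uminus ` E"] by simp
    also have "{x. x + - y \<in> uminus ` E} = {x. y - x \<in> E}" unfolding E' by simp
    also have "emeasure \<mu> \<dots> = (\<integral>\<^sup>+x. indicator {x. y - x \<in> E} x \<partial>\<mu>)"
      by (rule nn_integral_indicator[symmetric]) simp
    finally show ?thesis by (simp add: indicator_def)
  qed
  have "emeasure \<mu> A * emeasure \<nu> E = (\<integral>\<^sup>+y. (\<integral>\<^sup>+x. ?A x \<partial>\<mu>) * ?E y \<partial>\<nu>)"
    by (simp add: nn_integral_cmult)
  also have "\<dots> = (\<integral>\<^sup>+y. (\<integral>\<^sup>+x. ?A (x + y) * ?E y \<partial>\<mu>) \<partial>\<nu>)"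
  proof (rule nn_integral_cong_AE)
    show "AE y in \<nu>. (\<integral>\<^sup>+x. ?A x \<partial>\<mu>) * ?E y = (\<integral>\<^sup>+x. ?A (x + y) * ?E y \<partial>\<mu>)"
      using \<nu>.AE_W
    proof eventually_elim
      case (elim y)
      then show ?case using \<mu>.nn_integral_translate[of y ?A] by (simp add: nn_integral_multc)
    qed
  qed
  also have "\<dots> = (\<integral>\<^sup>+x. (\<integral>\<^sup>+y. ?A (x + y) * ?E y \<partial>\<nu>) \<partial>\<mu>)"
    by (rule Fubini') measurable
  also have "\<dots> = (\<integral>\<^sup>+x. (\<integral>\<^sup>+y. ?A y * ?E (y - x) \<partial>\<nu>) \<partial>\<mu>)"
  proof (rule nn_integral_cong_AE)
    show "AE x in \<mu>. (\<integral>\<^sup>+y. ?A (x + y) * ?E y \<partial>\<nu>) = (\<integral>\<^sup>+y. ?A y * ?E (y - x) \<partial>\<nu>)"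
      using \<mu>.AE_W
    proof eventually_elim
      case (elim x)
      then show ?case
        using \<nu>.nn_integral_translate[of x "\<lambda>y. ?A y * ?E (y - x)"] by (simp add: add.commute)
    qed
  qed
  also have "\<dots> = (\<integral>\<^sup>+y. (\<integral>\<^sup>+x. ?A y * ?E (y - x) \<partial>\<mu>) \<partial>\<nu>)"
    by (rule Fubini'[symmetric]) measurable
  also have "\<dots> = (\<integral>\<^sup>+y. ?A y * emeasure \<mu> (uminus ` E) \<partial>\<nu>)"
  proof (rule nn_integral_cong_AE)
    show "AE y in \<nu>. (\<integral>\<^sup>+x. ?A y * ?E (y - x) \<partial>\<mu>) = ?A y * emeasure \<mu> (uminus ` E)"
      using \<nu>.AE_W
    proof eventually_elim
      case (elim y)
      then show ?case using minus[of y] by (simp add: nn_integral_cmult)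
    qed
  qed
  also have "\<dots> = emeasure \<nu> A * emeasure \<mu> (uminus ` E)"
    by (simp add: nn_integral_multc)
  finally show ?thesis .
qed

section \<open>Lebesgue measure in lattice coordinates\<close>

definition coordinate_map :: "'i set \<Rightarrow> ('i \<Rightarrow> 'a::real_vector) \<Rightarrow> ('i \<Rightarrow> real) \<Rightarrow> 'a" where
  "coordinate_map I b c = (\<Sum>i\<in>I. c i *\<^sub>R b i)"

definition integer_span :: "'i set \<Rightarrow> ('i \<Rightarrow> 'a::real_vector) \<Rightarrow> 'a set" where
  "integer_span I b = range (\<lambda>k :: 'i \<Rightarrow> int. coordinate_map I b (\<lambda>i. of_int (k i)))"

text \<open>For a lattice basis this is Lebesgue measure on the span, scaled so that the lattice has
  covolume 1.\<close>

definition lattice_measure :: "'i set \<Rightarrow> ('i \<Rightarrow> 'a::euclidean_space) \<Rightarrow> 'a measure" where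
  "lattice_measure I b = distr (Pi\<^sub>M I (\<lambda>_. lborel)) borel (coordinate_map I b)"

lemma coordinate_map_add: "coordinate_map I b (\<lambda>i. c i + c' i) = coordinate_map I b c + coordinate_map I b c'"
  by (simp add: coordinate_map_def scaleR_add_left sum.distrib)

lemma coordinate_map_minus: "coordinate_map I b (\<lambda>i. - c i) = - coordinate_map I b c"
  by (simp add: coordinate_map_def sum_negf)

lemma integer_spanI: "coordinate_map I b (\<lambda>i. of_int (k i)) \<in> integer_span I b"
  by (simp add: integer_span_def)

lemma integer_span_add:
  assumes "u \<in> integer_span I b" "v \<in> integer_span I b"
  shows "u + v \<in> integer_span I b"
proof -
  obtain k l where "u = coordinate_map I b (\<lambda>i. of_int (k i))" "v = coordinate_map I b (\<lambda>i. of_int (l i))"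
    using assms unfolding integer_span_def by blast
  then have *: "u + v = coordinate_map I b (\<lambda>i. of_int (k i + l i))"
    by (simp add: coordinate_map_add)
  show ?thesis unfolding * by (rule integer_spanI)
qed

lemma integer_span_minus:
  assumes "u \<in> integer_span I b"
  shows "- u \<in> integer_span I b"
proof -
  obtain k where "u = coordinate_map I b (\<lambda>i. of_int (k i))"
    using assms unfolding integer_span_def by blast
  then have *: "- u = coordinate_map I b (\<lambda>i. of_int (- k i))"
    by (simp add: coordinate_map_minus)
  show ?thesis unfolding * by (rule integer_spanI)
qed

lemma measurable_translate:
  fixes v :: "'i \<Rightarrow> real"
  shows "(\<lambda>c. \<lambda>i\<in>I. c i + v i) \<in> measurable (Pi\<^sub>M I (\<lambda>_. lborel)) (Pi\<^sub>M I (\<lambda>_. lborel))"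
proof (rule measurable_restrict)
  fix i assume "i \<in> I"
  then show "(\<lambda>c. c i + v i) \<in> measurable (Pi\<^sub>M I (\<lambda>_. lborel)) lborel"
    using borel_measurable_add[OF measurable_coordinate borel_measurable_const] by simp
qed

lemma distr_PiM_lborel_translate:
  fixes v :: "'i \<Rightarrow> real"
  assumes I: "finite I"
  shows "distr (Pi\<^sub>M I (\<lambda>_. lborel)) (Pi\<^sub>M I (\<lambda>_. lborel)) (\<lambda>c. \<lambda>i\<in>I. c i + v i) = Pi\<^sub>M I (\<lambda>_. lborel)"
proof -
  interpret product_sigma_finite "\<lambda>_::'i. lborel :: real measure" by standard
  let ?M = "Pi\<^sub>M I (\<lambda>_. lborel :: real measure)"
  have [measurable]: "(\<lambda>c. \<lambda>i\<in>I. c i + v i) \<in> measurable ?M ?M"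
    by (rule measurable_translate)
  show ?thesis
  proof (rule PiM_eqI[OF I])
    fix A :: "'i \<Rightarrow> real set" assume "\<And>i. i \<in> I \<Longrightarrow> A i \<in> sets lborel"
    then have A [measurable]: "\<And>i. i \<in> I \<Longrightarrow> A i \<in> sets borel" by simp
    have "emeasure (distr ?M ?M (\<lambda>c. \<lambda>i\<in>I. c i + v i)) (Pi\<^sub>E I A) =
      emeasure ?M ((\<lambda>c. \<lambda>i\<in>I. c i + v i) -` Pi\<^sub>E I A \<inter> space ?M)"
      using I A by (intro emeasure_distr sets_PiM_I_finite) auto
    also have "(\<lambda>c. \<lambda>i\<in>I. c i + v i) -` Pi\<^sub>E I A \<inter> space ?M = Pi\<^sub>E I (\<lambda>i. {x. x + v i \<in> A i})"
      by (auto simp: space_PiM PiE_iff)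
    also have "emeasure ?M \<dots> = (\<Prod>i\<in>I. emeasure lborel {x. x + v i \<in> A i})"
      using A by (intro emeasure_PiM I) auto
    also have "\<dots> = (\<Prod>i\<in>I. emeasure lborel (A i))"
    proof (rule prod.cong[OF refl])
      fix i assume "i \<in> I"
      then have "emeasure (distr lborel borel ((+) (v i))) (A i) = emeasure lborel ((+) (v i) -` A i \<inter> space lborel)"
        using A by (intro emeasure_distr) auto
      then show "emeasure lborel {x. x + v i \<in> A i} = emeasure lborel (A i)"
        by (simp add: lborel_distr_plus vimage_def add.commute)
    qed
    finally show "emeasure (distr ?M ?M (\<lambda>c. \<lambda>i\<in>I. c i + v i)) (Pi\<^sub>E I A) = (\<Prod>i\<in>I. emeasure lborel (A i))" .
  qed simp
qed

locale lattice_basis =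
  fixes I :: "'i set" and b :: "'i \<Rightarrow> 'a::euclidean_space"
  assumes finite_I: "finite I" and inj_b: "inj_on b I" and independent_b: "independent (b ` I)"
begin

lemma coordinate_map_in_span: "coordinate_map I b c \<in> span (b ` I)"
  unfolding coordinate_map_def by (intro span_sum span_scale span_base) auto

lemma in_span_iff: "x \<in> span (b ` I) \<longleftrightarrow> (\<exists>c. x = coordinate_map I b c)"
proof
  assume "x \<in> span (b ` I)"
  then obtain u where "x = (\<Sum>v\<in>b ` I. u v *\<^sub>R v)"
    using span_finite[of "b ` I"] finite_I by auto
  then have "x = coordinate_map I b (u \<circ> b)"
    unfolding coordinate_map_def by (simp add: sum.reindex[OF inj_b])
  then show "\<exists>c. x = coordinate_map I b c" by blast
qed (auto simp: coordinate_map_in_span)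

text \<open>The dual basis, extended linearly to the whole space; linearity on the ambient space
  makes it Borel measurable.\<close>

definition coordinate :: "'i \<Rightarrow> 'a \<Rightarrow> real" where
  "coordinate i = (SOME g. linear g \<and> (\<forall>x\<in>b ` I. g x = of_bool (x = b i)))"

lemma coordinate: "linear (coordinate i)" "x \<in> b ` I \<Longrightarrow> coordinate i x = of_bool (x = b i)"
proof -
  have "\<exists>g. linear g \<and> (\<forall>x\<in>b ` I. g x = (of_bool (x = b i) :: real))"
    by (rule linear_independent_extend[OF independent_b])
  from someI_ex[OF this]
  show "linear (coordinate i)" "x \<in> b ` I \<Longrightarrow> coordinate i x = of_bool (x = b i)"
    unfolding coordinate_def by blast+
qed

lemma coordinate_measurable [measurable]: "coordinate i \<in> borel_measurable borel"
  by (intro borel_measurable_continuous_onI linear_continuous_on) (simp add: coordinate(1) linear_conv_bounded_linear[symmetric])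

lemma coordinate_coordinate_map:
  assumes "i \<in> I"
  shows "coordinate i (coordinate_map I b c) = c i"
proof -
  have "coordinate i (coordinate_map I b c) = (\<Sum>j\<in>I. c j * coordinate i (b j))"
    unfolding coordinate_map_def by (simp add: linear_sum[OF coordinate(1)] linear_cmul[OF coordinate(1)])
  also have "\<dots> = (\<Sum>j\<in>I. c j * of_bool (j = i))"
    using assms inj_b by (intro sum.cong) (auto simp: coordinate(2) inj_on_eq_iff)
  also have "\<dots> = c i" using finite_I assms by simp
  finally show ?thesis .
qed

lemma coordinate_map_measurable [measurable]:
  "coordinate_map I b \<in> borel_measurable (Pi\<^sub>M I (\<lambda>_. lborel))"
  unfolding coordinate_map_def
  by (intro borel_measurable_sum borel_measurable_scaleR borel_measurable_const)
    (rule measurable_coordinate)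

lemma emeasure_lattice_measure:
  "A \<in> sets borel \<Longrightarrow> emeasure (lattice_measure I b) A =
    emeasure (Pi\<^sub>M I (\<lambda>_. lborel)) {c \<in> I \<rightarrow>\<^sub>E UNIV. coordinate_map I b c \<in> A}"
  unfolding lattice_measure_def
  by (subst emeasure_distr) (auto simp: space_PiM intro!: arg_cong[where f = "emeasure _"])

sublocale translation_invariant "lattice_measure I b" "span (b ` I)"
proof
  let ?M = "Pi\<^sub>M I (\<lambda>_. lborel :: real measure)" and ?\<mu> = "lattice_measure I b"
  interpret product_sigma_finite "\<lambda>_::'i. lborel :: real measure" by standard
  \<comment> \<open>Sets of bounded coordinates exhaust the ambient space, and their preimages are
    cubes of finite measure: this gives sigma-finiteness.\<close>
  define B where "B n = {x. \<forall>i\<in>I. coordinate i x \<in> {- real n..real n}}" for n :: nat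
  have B: "B n \<in> sets borel" for n
  proof -
    have "{x \<in> space borel. \<forall>i\<in>I. coordinate i x \<in> {- real n..real n}} \<in> sets borel"
      using finite_I by (intro sets.sets_Collect_finite_All) measurable
    then show ?thesis by (simp add: B_def)
  qed
  have emeasure_B: "emeasure ?\<mu> (B n) \<noteq> \<infinity>" for n
  proof -
    have "{c \<in> I \<rightarrow>\<^sub>E UNIV. coordinate_map I b c \<in> B n} = Pi\<^sub>E I (\<lambda>_. {- real n..real n})"
      by (rule set_eqI) (simp add: B_def coordinate_coordinate_map PiE_iff conj_commute)
    then show ?thesis
      using B finite_I by (simp add: emeasure_lattice_measure emeasure_PiM ennreal_prod_eq_top power_eq_top_ennreal)
  qed
  have "\<exists>n. x \<in> B n" for x
  proof -
    obtain n where "(\<Sum>i\<in>I. \<bar>coordinate i x\<bar>) \<le> real n" using real_arch_simple by blast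
    moreover have "\<bar>coordinate i x\<bar> \<le> (\<Sum>i\<in>I. \<bar>coordinate i x\<bar>)" if "i \<in> I" for i
      using that finite_I by (intro member_le_sum) auto
    ultimately have "\<bar>coordinate i x\<bar> \<le> real n" if "i \<in> I" for i
      using that by (meson order_trans)
    then have "x \<in> B n" by (simp add: B_def abs_le_iff)
       (metis abs_le_iff minus_le_iff)
    then show ?thesis ..
  qed
  then have "(\<Union>n. B n) = UNIV" by blast
  then show "\<exists>A. countable A \<and> A \<subseteq> sets ?\<mu> \<and> \<Union> A = space ?\<mu> \<and> (\<forall>a\<in>A. emeasure ?\<mu> a \<noteq> \<infinity>)"
    using B emeasure_B by (intro exI[of _ "range B"]) (auto simp: lattice_measure_def)
  show "sets ?\<mu> = sets borel" by (simp add: lattice_measure_def)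
  show "subspace (span (b ` I))" by simp
  show "AE x in ?\<mu>. x \<in> span (b ` I)"
    unfolding lattice_measure_def
    by (subst AE_distr_iff) (auto simp: coordinate_map_in_span closed_span)
  fix w assume "w \<in> span (b ` I)"
  then obtain v where v: "w = coordinate_map I b v" using in_span_iff by blast
  have [measurable]: "(\<lambda>c. \<lambda>i\<in>I. c i + v i) \<in> measurable ?M ?M"
    by (rule measurable_translate)
  have shift: "coordinate_map I b c + w = coordinate_map I b (\<lambda>i\<in>I. c i + v i)" for c
    unfolding v coordinate_map_add[symmetric] by (auto simp: coordinate_map_def intro!: sum.cong)
  have "distr ?\<mu> borel (\<lambda>x. x + w) = distr ?M borel (\<lambda>c. coordinate_map I b c + w)"
    unfolding lattice_measure_def by (subst distr_distr) (auto simp: comp_def)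
  also have "\<dots> = distr (distr ?M ?M (\<lambda>c. \<lambda>i\<in>I. c i + v i)) borel (coordinate_map I b)"
    unfolding shift by (subst distr_distr) (auto simp: comp_def)
  also have "\<dots> = ?\<mu>"
    by (simp add: distr_PiM_lborel_translate[OF finite_I] lattice_measure_def)
  finally show "distr ?\<mu> borel (\<lambda>x. x + w) = ?\<mu>" .
qed

definition fundamental_domain :: "'a set" where
  "fundamental_domain = {x \<in> span (b ` I). \<forall>i\<in>I. coordinate i x \<in> {0..<1}}"

lemma coordinate_map_in_fundamental_domain:
  "coordinate_map I b c \<in> fundamental_domain \<longleftrightarrow> (\<forall>i\<in>I. c i \<in> {0..<1})"
  by (simp add: fundamental_domain_def coordinate_map_in_span coordinate_coordinate_map)

lemma fundamental_domain_borel: "fundamental_domain \<in> sets borel"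
proof -
  have "{x \<in> space borel. \<forall>i\<in>I. coordinate i x \<in> {0..<1}} \<in> sets borel"
    using finite_I by (intro sets.sets_Collect_finite_All) measurable
  then have "span (b ` I) \<inter> {x \<in> space borel. \<forall>i\<in>I. coordinate i x \<in> {0..<1}} \<in> sets borel"
    by (intro sets.Int) (auto simp: closed_span)
  moreover have "span (b ` I) \<inter> {x \<in> space borel. \<forall>i\<in>I. coordinate i x \<in> {0..<1}} = fundamental_domain"
    by (auto simp: fundamental_domain_def)
  ultimately show ?thesis by simp
qed

lemma emeasure_fundamental_domain: "emeasure (lattice_measure I b) fundamental_domain = 1"
proof -
  interpret product_sigma_finite "\<lambda>_::'i. lborel :: real measure" by standard
  have "{c \<in> I \<rightarrow>\<^sub>E UNIV. coordinate_map I b c \<in> fundamental_domain} = Pi\<^sub>E I (\<lambda>_. {0..<1})"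
    by (rule set_eqI) (simp add: coordinate_map_in_fundamental_domain PiE_iff conj_commute)
  then show ?thesis
    using fundamental_domain_borel finite_I by (simp add: emeasure_lattice_measure emeasure_PiM)
qed

lemma ex1_translate_fundamental_domain:
  assumes "w \<in> span (b ` I)"
  shows "\<exists>!z. z \<in> integer_span I b \<and> w + z \<in> fundamental_domain"
proof -
  obtain c where w: "w = coordinate_map I b c" using assms in_span_iff by blast
  have mem: "w + coordinate_map I b (\<lambda>i. of_int (k i)) \<in> fundamental_domain \<longleftrightarrow> (\<forall>i\<in>I. k i = - \<lfloor>c i\<rfloor>)" for k
  proof -
    have "c i + of_int (k i) \<in> {0..<1} \<longleftrightarrow> k i = - \<lfloor>c i\<rfloor>" for i
      by (simp add: eq_neg_iff_add_eq_0 add.commute[of "k i"] floor_eq_iff[of "c i"] minus_equation_iff[of "k i"])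
        linarith
    then show ?thesis
      unfolding w coordinate_map_add[symmetric] coordinate_map_in_fundamental_domain by blast
  qed
  show ?thesis
  proof (rule ex1I)
    let ?z = "coordinate_map I b (\<lambda>i. of_int (- \<lfloor>c i\<rfloor>))"
    show "?z \<in> integer_span I b \<and> w + ?z \<in> fundamental_domain"
      using mem[of "\<lambda>i. - \<lfloor>c i\<rfloor>"] integer_spanI[of I b "\<lambda>i. - \<lfloor>c i\<rfloor>"] by simp
    fix z assume z: "z \<in> integer_span I b \<and> w + z \<in> fundamental_domain"
    then obtain k where "z = coordinate_map I b (\<lambda>i. of_int (k i))" by (auto simp: integer_span_def)
    then show "z = ?z" using z mem[of k] by (simp add: coordinate_map_def)
  qed
qed

lemma integer_span_subset: "integer_span I b \<subseteq> span (b ` I)"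
  by (auto simp: integer_span_def coordinate_map_in_span)

lemma countable_integer_span: "countable (integer_span I b)"
proof -
  have sub: "integer_span I b \<subseteq> (\<lambda>k. coordinate_map I b (\<lambda>i. of_int (k i))) ` (I \<rightarrow>\<^sub>E (UNIV :: int set))"
  proof
    fix z assume "z \<in> integer_span I b"
    then obtain k where "z = coordinate_map I b (\<lambda>i. of_int (k i))" by (auto simp: integer_span_def)
    then have "z = coordinate_map I b (\<lambda>i. of_int (restrict k I i))" by (simp add: coordinate_map_def)
    then show "z \<in> (\<lambda>k. coordinate_map I b (\<lambda>i. of_int (k i))) ` (I \<rightarrow>\<^sub>E (UNIV :: int set))"
      by (rule image_eqI[where x = "restrict k I"]) simp
  qed
  show ?thesis
    by (rule countable_subset[OF sub countable_image[OF countable_PiE[OF finite_I]]]) (rule countableI_type)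
qed

lemma span_integer_span: "span (integer_span I b) = span (b ` I)"
proof (rule antisym)
  show "span (integer_span I b) \<subseteq> span (b ` I)"
    using integer_span_subset by (simp add: span_minimal)
  have "b j \<in> integer_span I b" if "j \<in> I" for j
  proof -
    have "coordinate_map I b (\<lambda>i. of_int (if i = j then 1 else 0)) = (\<Sum>i\<in>I. if i = j then b i else 0)"
      unfolding coordinate_map_def by (intro sum.cong) auto
    also have "\<dots> = b j" using that finite_I by simp
    finally show ?thesis using integer_spanI[of I b "\<lambda>i. if i = j then 1 else 0"] by simp
  qed
  then show "span (b ` I) \<subseteq> span (integer_span I b)" by (intro span_mono) auto
qed

end

text \<open>Equal lattices have equal spans, so both measures are invariant on the same subspace and
  hence proportional. The factor is 1 because both give mass 1 to the fundamental domains of the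
  common lattice.\<close>

lemma lattice_measure_unique:
  fixes b :: "'i \<Rightarrow> 'a::euclidean_space" and c :: "'j \<Rightarrow> 'a"
  assumes "lattice_basis I b" "lattice_basis J c" and eq: "integer_span I b = integer_span J c"
  shows "lattice_measure I b = lattice_measure J c"
proof -
  interpret b: lattice_basis I b by fact
  interpret c: lattice_basis J c by fact
  let ?E = "c.fundamental_domain" and ?W = "span (b ` I)"
  have W: "span (c ` J) = ?W" using b.span_integer_span c.span_integer_span eq by simp
  have E': "uminus ` ?E = {x. - x \<in> ?E}" by (auto intro: image_eqI[of _ uminus "- x" for x])
  have "{x \<in> space borel. - x \<in> ?E} \<in> sets borel"
    using c.fundamental_domain_borel by measurable
  then have E_borel: "uminus ` ?E \<in> sets borel" unfolding E' by simp
  \<comment> \<open>Proportionality produces the reflection of \<open>?E\<close>. A lattice is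
    symmetric, so the reflection is again a fundamental domain.\<close>
  have "emeasure (lattice_measure I b) (uminus ` ?E) = emeasure (lattice_measure I b) b.fundamental_domain"
  proof (rule b.emeasure_fundamental_domains[OF b.countable_integer_span b.integer_span_subset integer_span_minus
        E_borel _ _ b.fundamental_domain_borel _ b.ex1_translate_fundamental_domain])
    show "uminus ` ?E \<subseteq> ?W" "b.fundamental_domain \<subseteq> ?W"
      using W by (auto simp: c.fundamental_domain_def b.fundamental_domain_def intro: span_neg)
    fix w assume "w \<in> ?W"
    then have "- w \<in> span (c ` J)" using W by (simp add: span_neg)
    from c.ex1_translate_fundamental_domain[OF this]
    obtain z where z: "z \<in> integer_span I b" "- w + z \<in> ?E"
      and unique: "\<And>z'. z' \<in> integer_span I b \<Longrightarrow> - w + z' \<in> ?E \<Longrightarrow> z' = z"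
      unfolding eq by blast
    show "\<exists>!z. z \<in> integer_span I b \<and> w + z \<in> uminus ` ?E"
    proof (rule ex1I[of _ "- z"])
      show "- z \<in> integer_span I b \<and> w + - z \<in> uminus ` ?E"
        using z integer_span_minus by (auto simp: E' algebra_simps)
      fix z' assume "z' \<in> integer_span I b \<and> w + z' \<in> uminus ` ?E"
      then have "- z' = z" using integer_span_minus by (intro unique) (auto simp: E' algebra_simps)
      then show "z' = - z" by (metis minus_minus)
    qed
  qed
  then have one: "emeasure (lattice_measure I b) (uminus ` ?E) = 1"
    by (simp add: b.emeasure_fundamental_domain)
  have "translation_invariant (lattice_measure J c) ?W"
    using c.translation_invariant_axioms W by simp
  note proportional = translation_invariant_proportional[OF b.translation_invariant_axioms this _ c.fundamental_domain_borel]
  show ?thesis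
  proof (rule measure_eqI)
    fix A assume "A \<in> sets (lattice_measure I b)"
    then show "emeasure (lattice_measure I b) A = emeasure (lattice_measure J c) A"
      using proportional[of A] by (simp add: one c.emeasure_fundamental_domain)
  qed simp
qed

text \<open>Bridges indexed families such as \<open>reroute\<close> and the bare sets of vectors
  used in \<open>lattice_frame\<close>.\<close>

lemma integer_span_image:
  assumes "inj_on b I"
  shows "integer_span (b ` I) id = integer_span I b"
proof (rule antisym)
  show "integer_span (b ` I) id \<subseteq> integer_span I b"
  proof
    fix z assume "z \<in> integer_span (b ` I) id"
    then obtain k where "z = coordinate_map (b ` I) id (\<lambda>v. of_int (k v))"
      by (auto simp: integer_span_def)
    then have "z = coordinate_map I b (\<lambda>i. of_int (k (b i)))"
      by (simp add: coordinate_map_def sum.reindex[OF assms])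
    then show "z \<in> integer_span I b" using integer_spanI[of I b "\<lambda>i. k (b i)"] by simp
  qed
  show "integer_span I b \<subseteq> integer_span (b ` I) id"
  proof
    fix z assume "z \<in> integer_span I b"
    then obtain k where k: "z = coordinate_map I b (\<lambda>i. of_int (k i))"
      by (auto simp: integer_span_def)
    have "z = coordinate_map (b ` I) id (\<lambda>v. of_int (k (inv_into I b v)))"
      unfolding k by (simp add: coordinate_map_def sum.reindex[OF assms] inv_into_f_f[OF assms])
    then show "z \<in> integer_span (b ` I) id"
      using integer_spanI[of "b ` I" id "\<lambda>v. k (inv_into I b v)"] by simp
  qed
qed

lemma lattice_frame_iff:
  "lattice_frame A (p, B) \<longleftrightarrow>
    lattice_basis B id \<and> A \<inter> integer_points = (+) p ` integer_span B id"
  using finiteI_independent[of B]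
  by (auto simp: lattice_frame_def lattice_basis_def integer_span_def coordinate_map_def image_image)

lemma lattice_translate_eq:
  assumes "(+) p ` integer_span I b = (+) p' ` integer_span J c"
  shows "p' - p \<in> integer_span I b" "integer_span I b = integer_span J c"
proof -
  have zero: "0 \<in> integer_span J c"
    using integer_spanI[of J c "\<lambda>_. 0"] by (simp add: coordinate_map_def)
  then have "p' \<in> (+) p ` integer_span I b" unfolding assms by (auto intro: image_eqI[of _ _ 0])
  then obtain z where z: "p' = p + z" "z \<in> integer_span I b" by blast
  then show "p' - p \<in> integer_span I b" by simp
  show "integer_span I b = integer_span J c"
  proof (rule antisym; rule subsetI)
    fix u assume "u \<in> integer_span I b"
    then have "p + (z + u) \<in> (+) p' ` integer_span J c"
      using integer_span_add[OF z(2)] unfolding assms[symmetric] by blast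
    then show "u \<in> integer_span J c" using z(1) by (auto simp: add.assoc)
  next
    fix u assume "u \<in> integer_span J c"
    then have "p' + u \<in> (+) p ` integer_span I b" unfolding assms by blast
    then have "z + u \<in> integer_span I b" using z(1) by (auto simp: add.assoc)
    from integer_span_add[OF integer_span_minus[OF z(2)] this] show "u \<in> integer_span I b" by simp
  qed
qed

text \<open>The frame chosen by \<open>SOME\<close> is unknown. It has the same lattice, hence the
  same \<open>lattice_measure\<close>, and its base point differs by a lattice vector, under which
  that measure is invariant.\<close>

lemma relative_volume_eq:
  fixes b :: "'i \<Rightarrow> real ^ 'e"
  assumes basis: "lattice_basis I b" and P: "P \<in> sets borel"
    and lattice: "affine hull P \<inter> integer_points = (+) p ` integer_span I b"
  shows "relative_volume P =
    measure (Pi\<^sub>M I (\<lambda>_. lborel)) {c \<in> I \<rightarrow>\<^sub>E UNIV. p + coordinate_map I b c \<in> P}"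
proof -
  interpret lattice_basis I b by fact
  have "lattice_basis (b ` I) id"
    using finite_I independent_b by (simp add: lattice_basis_def)
  then have "lattice_frame (affine hull P) (p, b ` I)"
    using lattice by (simp add: lattice_frame_iff integer_span_image[OF inj_b])
  then have frame: "lattice_frame (affine hull P) (SOME F. lattice_frame (affine hull P) F)"
    by (rule someI)
  obtain p' B where F: "(SOME F. lattice_frame (affine hull P) F) = (p', B)"
    by (cases "SOME F. lattice_frame (affine hull P) F") auto
  have B: "lattice_basis B id" and eq: "(+) p ` integer_span I b = (+) p' ` integer_span B id"
    using frame lattice unfolding F lattice_frame_iff by simp_all
  interpret B: lattice_basis B id by fact
  have vol: "measure (Pi\<^sub>M J (\<lambda>_. lborel)) {c \<in> J \<rightarrow>\<^sub>E UNIV. q + coordinate_map J c' c \<in> P} =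
      measure (lattice_measure J c') {x. q + x \<in> P}"
    if "lattice_basis J c'" for J :: "'j set" and c' :: "'j \<Rightarrow> real ^ 'e" and q
  proof -
    have "{x \<in> space borel. q + x \<in> P} \<in> sets borel" using P by measurable
    then show ?thesis
      using lattice_basis.emeasure_lattice_measure[OF that, of "{x. q + x \<in> P}"] by (simp add: measure_def)
  qed
  have "relative_volume P = measure (Pi\<^sub>M B (\<lambda>_. lborel)) {c \<in> B \<rightarrow>\<^sub>E UNIV. p' + coordinate_map B id c \<in> P}"
    unfolding relative_volume_def F by (simp add: coordinate_map_def)
  also have "\<dots> = measure (lattice_measure B id) {x. p' + x \<in> P}" by (rule vol[OF B])
  also have "lattice_measure B id = lattice_measure I b"
    using lattice_measure_unique[OF basis B] lattice_translate_eq(2)[OF eq] by simp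
  also have "measure (lattice_measure I b) {x. p' + x \<in> P} = measure (lattice_measure I b) {x. p + x \<in> P}"
  proof -
    have "{x \<in> space borel. p + x \<in> P} \<in> sets borel" using P by measurable
    moreover have "{x. x + (p' - p) \<in> {x. p + x \<in> P}} = {x. p' + x \<in> P}" by (simp add: algebra_simps)
    moreover have "p' - p \<in> span (b ` I)" using lattice_translate_eq(1)[OF eq] integer_span_subset by blast
    ultimately show ?thesis
      using emeasure_translate[of "p' - p" "{x. p + x \<in> P}"] by (simp add: measure_def)
  qed
  also have "\<dots> = measure (Pi\<^sub>M I (\<lambda>_. lborel)) {c \<in> I \<rightarrow>\<^sub>E UNIV. p + coordinate_map I b c \<in> P}"
    by (rule vol[OF basis, symmetric])
  finally show ?thesis .
qed

section \<open>Flow polytopes of spinal graphs\<close>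

lemma closed_flow_polytope: "closed (flow_polytope G n)"
proof -
  have "flow_polytope G n = (\<Inter>e\<in>- arcs G. {f. f $ e = 0}) \<inter> (\<Inter>e\<in>arcs G. {f. 0 \<le> f $ e}) \<inter>
    (\<Inter>i\<in>{1..n+1}. {f. netflow n i + (\<Sum>e\<in>in_arcs G i. f $ e) = (\<Sum>e\<in>out_arcs G i. f $ e)})"
    by (auto simp: flow_polytope_def)
  then show ?thesis
    by (simp only:) (intro closed_Int closed_INT ballI closed_Collect_eq closed_Collect_le continuous_intros)
qed

locale labeled_spinal_graph = spinal_graph G n x
  for G :: "(nat, 'e::finite) pre_digraph" and n :: nat and x :: "nat \<Rightarrow> 'e" +
  fixes d :: nat and y :: "nat \<Rightarrow> 'e"
  assumes canonical: "canonical_labeling G n x d y"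
begin

lemma inj_y: "inj_on y {1..d}" and y_image: "y ` {1..d} = arcs G - x ` {1..n}"
  using canonical by (simp_all add: canonical_labeling_def bij_betw_def)

lemma y_arc: "j \<in> {1..d} \<Longrightarrow> y j \<in> arcs G" and y_not_slack: "j \<in> {1..d} \<Longrightarrow> y j \<notin> x ` {1..n}"
  using y_image by blast+

lemma inj_x: "inj_on x {1..n}"
  by (metis inj_onI tail_slack)

lemma y_tail_less_head: "j \<in> {1..d} \<Longrightarrow> tail G (y j) < head G (y j)"
  using y_arc tail_less_head by blast

lemma arc_bounds: "e \<in> arcs G \<Longrightarrow> 1 \<le> tail G e" "e \<in> arcs G \<Longrightarrow> head G e \<le> n + 1"
  using tail_in_verts[of e] head_in_verts[of e] verts_eq by auto

lemma tail_mono: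
  assumes "1 \<le> k" "k \<le> j" "j \<le> d"
  shows "tail G (y k) \<le> tail G (y j)"
proof (cases "k = j")
  case False
  have "k \<in> {1..d}" "j \<in> {1..d}" "k < j" using assms False by auto
  then show ?thesis using canonical unfolding canonical_labeling_def by fastforce
qed simp

section \<open>Flow conservation expressed by cuts of the spine\<close>

definition crossing :: "nat \<Rightarrow> nat set" where
  "crossing i = {k \<in> {1..d}. tail G (y k) \<le> i \<and> i < head G (y k)}"

lemma finite_crossing: "finite (crossing i)"
  by (simp add: crossing_def)

text \<open>A slack edge spans a single step, so \<open>x i\<close> is the only slack edge over the
  cut between \<open>i\<close> and \<open>i + 1\<close>.\<close>

lemma sum_cut:
  assumes "i \<in> {1..n}"
  shows "(\<Sum>e | e \<in> arcs G \<and> tail G e \<le> i \<and> i < head G e. f e) = f (x i) + (\<Sum>k\<in>crossing i. f (y k))"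
proof -
  let ?C = "{e. e \<in> arcs G \<and> tail G e \<le> i \<and> i < head G e}"
  have "?C = insert (x i) (y ` crossing i)"
  proof (rule antisym; rule subsetI)
    fix e assume e: "e \<in> ?C"
    show "e \<in> insert (x i) (y ` crossing i)"
    proof (cases "e \<in> x ` {1..n}")
      case True
      then obtain k where k: "k \<in> {1..n}" "e = x k" by blast
      then have "k \<le> i" "i < k + 1" using e tail_slack[of k] head_slack[of k] by simp_all
      then have "k = i" by linarith
      then show ?thesis using k by simp
    next
      case False
      then obtain k where "k \<in> {1..d}" "e = y k" using e y_image by blast
      then show ?thesis using e by (auto simp: crossing_def)
    qed
  next
    fix e assume "e \<in> insert (x i) (y ` crossing i)"
    then show "e \<in> ?C"
      using assms slack_in_arcs[of i] tail_slack[of i] head_slack[of i] y_arc by (auto simp: crossing_def)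
  qed
  moreover have "x i \<notin> y ` crossing i"
  proof
    assume "x i \<in> y ` crossing i"
    then obtain k where "k \<in> {1..d}" "x i = y k" by (auto simp: crossing_def)
    then show False using y_not_slack[of k] assms by (metis imageI)
  qed
  moreover have "inj_on y (crossing i)" using inj_y by (rule inj_on_subset) (auto simp: crossing_def)
  ultimately show ?thesis by (simp add: sum.reindex finite_crossing)
qed

text \<open>Conservation at \<open>i\<close> is the difference of two neighbouring cut equations; as
  the outermost cuts are empty, telescoping gives one unit of flow over every inner cut.\<close>

lemma conservation_iff_cuts:
  fixes f :: "'e \<Rightarrow> real"
  shows "(\<forall>i\<in>{1..n+1}. netflow n i + (\<Sum>e\<in>in_arcs G i. f e) = (\<Sum>e\<in>out_arcs G i. f e)) \<longleftrightarrow>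
    (\<forall>i\<in>{1..n}. f (x i) + (\<Sum>k\<in>crossing i. f (y k)) = 1)"
proof -
  define cut where "cut i = (\<Sum>e | e \<in> arcs G \<and> tail G e \<le> i \<and> i < head G e. f e)" for i
  \<comment> \<open>Moving the cut past vertex \<open>i\<close> replaces the edges into
    \<open>i\<close> by the edges out of \<open>i\<close>; the edges passing over \<open>i\<close>
    stay.\<close>
  have step: "cut i + (\<Sum>e\<in>in_arcs G i. f e) = cut (i - 1) + (\<Sum>e\<in>out_arcs G i. f e)" if "1 \<le> i" for i
  proof -
    let ?M = "{e. e \<in> arcs G \<and> tail G e < i \<and> i < head G e}"
    have "{e. e \<in> arcs G \<and> tail G e \<le> i \<and> i < head G e} = ?M \<union> out_arcs G i"
      using tail_less_head by (auto simp: out_arcs_def)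
    moreover have "{e. e \<in> arcs G \<and> tail G e \<le> i - 1 \<and> i - 1 < head G e} = ?M \<union> in_arcs G i"
      using tail_less_head that by (auto simp: in_arcs_def) (metis Suc_pred le_less_linear less_Suc_eq_le not_less_eq)+
    moreover have "sum f (?M \<union> out_arcs G i) = sum f ?M + sum f (out_arcs G i)"
      "sum f (?M \<union> in_arcs G i) = sum f ?M + sum f (in_arcs G i)"
      by (intro sum.union_disjoint; auto simp: out_arcs_def in_arcs_def)+
    ultimately show ?thesis by (simp add: cut_def)
  qed
  have cut_0: "cut 0 = 0" and cut_last: "cut (n + 1) = 0"
  proof -
    have "{e. e \<in> arcs G \<and> tail G e \<le> 0 \<and> 0 < head G e} = {}"
      "{e. e \<in> arcs G \<and> tail G e \<le> n + 1 \<and> n + 1 < head G e} = {}"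
      using arc_bounds by force+
    then show "cut 0 = 0" "cut (n + 1) = 0" by (simp_all add: cut_def del: Collect_empty_eq)
  qed
  have "(\<forall>i\<in>{1..n+1}. netflow n i + (\<Sum>e\<in>in_arcs G i. f e) = (\<Sum>e\<in>out_arcs G i. f e)) \<longleftrightarrow>
    (\<forall>i\<in>{1..n+1}. cut i = cut (i - 1) + netflow n i)"
  proof (intro ball_cong refl)
    fix i assume "i \<in> {1..n+1}"
    then have "cut i + (\<Sum>e\<in>in_arcs G i. f e) = cut (i - 1) + (\<Sum>e\<in>out_arcs G i. f e)" using step by simp
    then show "(netflow n i + (\<Sum>e\<in>in_arcs G i. f e) = (\<Sum>e\<in>out_arcs G i. f e)) \<longleftrightarrow>
      cut i = cut (i - 1) + netflow n i" by linarith
  qed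
  also have "\<dots> \<longleftrightarrow> (\<forall>i\<in>{1..n}. cut i = 1)"
  proof
    assume L: "\<forall>i\<in>{1..n+1}. cut i = cut (i - 1) + netflow n i"
    have "i \<in> {1..n} \<longrightarrow> cut i = 1" for i
    proof (induction i)
      case (Suc i)
      then show ?case using L[rule_format, of "Suc i"] cut_0 by (cases "i = 0") (auto simp: netflow_def)
    qed simp
    then show "\<forall>i\<in>{1..n}. cut i = 1" by blast
  next
    assume R: "\<forall>i\<in>{1..n}. cut i = 1"
    show "\<forall>i\<in>{1..n+1}. cut i = cut (i - 1) + netflow n i"
    proof
      fix i assume i: "i \<in> {1..n+1}"
      \<comment> \<open>For \<open>n = 0\<close> source and sink coincide, so the net flow there is
        0 rather than 1.\<close>
      consider "i = 1" "n = 0" | "i = 1" "n > 0" | "1 < i" "i \<le> n" | "i = n + 1" "n > 0" using i by force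
      then show "cut i = cut (i - 1) + netflow n i"
      proof cases
        case 1
        then show ?thesis using cut_0 cut_last by (simp add: netflow_def)
      next
        case 2
        then show ?thesis using cut_0 R by (simp add: netflow_def)
      next
        case 3
        then have "i \<in> {1..n}" "i - 1 \<in> {1..n}" by auto
        then show ?thesis using R 3 by (simp add: netflow_def)
      next
        case 4
        then have "n \<in> {1..n}" by auto
        then show ?thesis using R cut_last 4 by (simp add: netflow_def)
      qed
    qed
  qed
  also have "\<dots> \<longleftrightarrow> (\<forall>i\<in>{1..n}. f (x i) + (\<Sum>k\<in>crossing i. f (y k)) = 1)"
    by (intro ball_cong refl) (simp add: cut_def sum_cut)
  finally show ?thesis .
qed

section \<open>Lattice coordinates given by the non-slack edges\<close>

definition slack_flow :: "real ^ 'e" where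
  "slack_flow = (\<chi> e. of_bool (e \<in> x ` {1..n}))"

text \<open>Rerouting one unit of flow from the slack path to the edge \<open>y j\<close>.\<close>

definition reroute :: "nat \<Rightarrow> real ^ 'e" where
  "reroute j = (\<chi> e. of_bool (e = y j) - of_bool (e \<in> x ` {tail G (y j)..<head G (y j)}))"

abbreviation flow_of :: "(nat \<Rightarrow> real) \<Rightarrow> real ^ 'e" where
  "flow_of c \<equiv> slack_flow + coordinate_map {1..d} reroute c"

lemma coordinate_map_reroute_nth:
  "coordinate_map {1..d} reroute c $ e =
    (\<Sum>k\<in>{1..d}. c k * (of_bool (e = y k) - of_bool (e \<in> x ` {tail G (y k)..<head G (y k)})))"
  by (simp add: coordinate_map_def reroute_def)

lemma slack_range: "k \<in> {1..d} \<Longrightarrow> {tail G (y k)..<head G (y k)} \<subseteq> {1..n}"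
  using arc_bounds[OF y_arc[of k]] by auto

lemma reroute_nth_y:
  assumes "j \<in> {1..d}"
  shows "coordinate_map {1..d} reroute c $ y j = c j"
proof -
  have "y j \<notin> x ` {tail G (y k)..<head G (y k)}" if "k \<in> {1..d}" for k
    using y_not_slack[OF assms] slack_range[OF that] by blast
  then have "coordinate_map {1..d} reroute c $ y j = (\<Sum>k\<in>{1..d}. c k * of_bool (k = j))"
    unfolding coordinate_map_reroute_nth using assms inj_y
    by (intro sum.cong) (auto simp: inj_on_eq_iff)
  then show ?thesis using assms by simp
qed

lemma flow_of_y: "j \<in> {1..d} \<Longrightarrow> flow_of c $ y j = c j"
  using reroute_nth_y y_not_slack by (simp add: slack_flow_def)

lemma flow_of_x:
  assumes "i \<in> {1..n}"
  shows "flow_of c $ x i = 1 - (\<Sum>k\<in>crossing i. c k)"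
proof -
  have "x i \<noteq> y k" if "k \<in> {1..d}" for k
    using y_not_slack[OF that] assms by (metis imageI)
  moreover have "x i \<in> x ` {tail G (y k)..<head G (y k)} \<longleftrightarrow> k \<in> crossing i" if "k \<in> {1..d}" for k
    unfolding inj_on_image_mem_iff[OF inj_x assms slack_range[OF that]] using that by (simp add: crossing_def)
  ultimately have "coordinate_map {1..d} reroute c $ x i = (\<Sum>k\<in>{1..d}. if k \<in> crossing i then - c k else 0)"
    unfolding coordinate_map_reroute_nth by (intro sum.cong) auto
  also have "\<dots> = - (\<Sum>k\<in>crossing i. c k)"
    by (simp add: sum.If_cases sum_negf crossing_def Int_def conj_commute)
  finally show ?thesis using assms by (simp add: slack_flow_def)
qed

lemma flow_of_other:
  assumes "e \<notin> arcs G"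
  shows "flow_of c $ e = 0"
proof -
  have "e \<notin> x ` {1..n}" "\<And>k. k \<in> {1..d} \<Longrightarrow> e \<noteq> y k" using assms slack_in_arcs y_arc by blast+
  moreover from this have "e \<notin> x ` {tail G (y k)..<head G (y k)}" if "k \<in> {1..d}" for k
    using slack_range[OF that] by blast
  ultimately show ?thesis
    unfolding vector_add_component coordinate_map_reroute_nth by (simp add: slack_flow_def)
qed

lemma arcs_split: "arcs G = x ` {1..n} \<union> y ` {1..d}"
  using y_image slack_in_arcs by blast

text \<open>Conservation is built into \<open>flow_of\<close>, so only nonnegativity remains; on the
  slack edges it becomes the bound on each cut.\<close>

lemma flow_of_in_polytope_iff:
  "flow_of c \<in> flow_polytope G n \<longleftrightarrow>
    (\<forall>j\<in>{1..d}. 0 \<le> c j) \<and> (\<forall>i\<in>{1..n}. (\<Sum>k\<in>crossing i. c k) \<le> 1)"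
proof -
  have "(\<Sum>k\<in>crossing i. flow_of c $ y k) = (\<Sum>k\<in>crossing i. c k)" for i
    by (intro sum.cong flow_of_y) (auto simp: crossing_def)
  then have "\<forall>i\<in>{1..n}. flow_of c $ x i + (\<Sum>k\<in>crossing i. flow_of c $ y k) = 1"
    using flow_of_x by simp
  then have "flow_of c \<in> flow_polytope G n \<longleftrightarrow> (\<forall>e\<in>arcs G. 0 \<le> flow_of c $ e)"
    unfolding flow_polytope_def conservation_iff_cuts[of "\<lambda>e. _ $ e"] using flow_of_other by simp
  also have "\<dots> \<longleftrightarrow> (\<forall>i\<in>{1..n}. 0 \<le> flow_of c $ x i) \<and> (\<forall>j\<in>{1..d}. 0 \<le> flow_of c $ y j)"
    unfolding arcs_split by blast
  also have "\<dots> \<longleftrightarrow> (\<forall>j\<in>{1..d}. 0 \<le> c j) \<and> (\<forall>i\<in>{1..n}. (\<Sum>k\<in>crossing i. c k) \<le> 1)"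
    using flow_of_x[of _ c] flow_of_y[of _ c] by (simp add: conj_commute)
  finally show ?thesis .
qed

lemma flow_eq_flow_of:
  assumes "f \<in> flow_polytope G n"
  shows "f = flow_of (\<lambda>j. f $ y j)"
proof -
  have zero: "\<And>e. e \<notin> arcs G \<Longrightarrow> f $ e = 0"
    and cuts: "\<And>i. i \<in> {1..n} \<Longrightarrow> f $ x i + (\<Sum>k\<in>crossing i. f $ y k) = 1"
    using assms conservation_iff_cuts[of "\<lambda>e. f $ e"] unfolding flow_polytope_def by blast+
  have "f $ e = flow_of (\<lambda>j. f $ y j) $ e" for e
  proof -
    consider "e \<notin> arcs G" | i where "i \<in> {1..n}" "e = x i" | j where "j \<in> {1..d}" "e = y j"
      using arcs_split by blast
    then show ?thesis
    proof cases
      case 1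
      then show ?thesis using zero flow_of_other by metis
    next
      case 2
      then show ?thesis unfolding 2(2) using cuts[OF 2(1)] flow_of_x[OF 2(1), of "\<lambda>j. f $ y j"] by linarith
    next
      case 3
      then show ?thesis unfolding 3(2) using flow_of_y[OF 3(1), of "\<lambda>j. f $ y j"] by simp
    qed
  qed
  then show ?thesis by (rule vec_eq_iff[THEN iffD2, rule_format])
qed

text \<open>At the entries \<open>y 1, ..., y d\<close> the vectors \<open>reroute k\<close> form
  the identity matrix.\<close>

lemma lattice_basis_reroute: "lattice_basis {1..d} reroute"
proof
  have reroute_nth: "reroute k $ y j = of_bool (k = j)" if "j \<in> {1..d}" "k \<in> {1..d}" for j k
  proof -
    have "coordinate_map {1..d} reroute (\<lambda>i. of_bool (i = k)) = reroute k"
      unfolding coordinate_map_def using that by (simp add: of_bool_def if_distrib[of "\<lambda>r. r *\<^sub>R _"] cong: if_cong)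
    then show ?thesis using reroute_nth_y[OF that(1), of "\<lambda>i. of_bool (i = k)"] by auto
  qed
  show inj: "inj_on reroute {1..d}"
  proof (rule inj_onI)
    fix j k assume jk: "j \<in> {1..d}" "k \<in> {1..d}" and "reroute j = reroute k"
    then have "reroute j $ y j = reroute k $ y j" by metis
    then show "j = k" unfolding reroute_nth[OF jk(1,1)] reroute_nth[OF jk] by (cases "k = j") simp_all
  qed
  show "independent (reroute ` {1..d})"
  proof (rule independent_if_scalars_zero)
    fix u v assume sum: "(\<Sum>v\<in>reroute ` {1..d}. u v *\<^sub>R v) = 0" and "v \<in> reroute ` {1..d}"
    then obtain j where j: "j \<in> {1..d}" "v = reroute j" by blast
    have "coordinate_map {1..d} reroute (\<lambda>k. u (reroute k)) = 0"
      using sum unfolding coordinate_map_def sum.reindex[OF inj] comp_def .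
    then show "u v = 0" using reroute_nth_y[OF j(1), of "\<lambda>k. u (reroute k)"] j(2) by simp
  qed simp
qed simp

lemma affine_hull_flow_polytope: "affine hull flow_polytope G n = (+) slack_flow ` span (reroute ` {1..d})"
proof -
  interpret lattice_basis "{1..d}" reroute by (rule lattice_basis_reroute)
  let ?P = "flow_polytope G n"
  have "flow_of (\<lambda>_. 0) \<in> ?P" unfolding flow_of_in_polytope_iff by simp
  then have base: "slack_flow \<in> ?P" by (simp add: coordinate_map_def)
  have vertex: "slack_flow + reroute j \<in> ?P" if "j \<in> {1..d}" for j
  proof -
    have "coordinate_map {1..d} reroute (\<lambda>i. if i = j then 1 else 0) = (\<Sum>i\<in>{1..d}. if i = j then reroute i else 0)"
      unfolding coordinate_map_def by (intro sum.cong) auto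
    also have "\<dots> = reroute j" using that by simp
    finally have "coordinate_map {1..d} reroute (\<lambda>i. if i = j then 1 else 0) = reroute j" .
    \<comment> \<open>For a unit vector every cut sum is 0 or 1, so the point satisfies all bounds.
      With \<open>slack_flow\<close> these points span the hull.\<close>
    moreover have "flow_of (\<lambda>i. if i = j then 1 else 0) \<in> ?P"
      unfolding flow_of_in_polytope_iff by (simp add: finite_crossing)
    ultimately show ?thesis by simp
  qed
  have "(\<lambda>f. - slack_flow + f) ` ?P \<subseteq> span (reroute ` {1..d})"
  proof
    fix v assume "v \<in> (\<lambda>f. - slack_flow + f) ` ?P"
    then obtain f where f: "f \<in> ?P" "v = - slack_flow + f" by blast
    obtain c where "f = flow_of c" using flow_eq_flow_of[OF f(1)] by (rule that)
    then have "v = coordinate_map {1..d} reroute c" using f(2) by simp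
    then show "v \<in> span (reroute ` {1..d})" using coordinate_map_in_span by simp
  qed
  then have "span ((\<lambda>f. - slack_flow + f) ` ?P) \<subseteq> span (reroute ` {1..d})"
    by (rule span_minimal) simp
  moreover have "reroute ` {1..d} \<subseteq> (\<lambda>f. - slack_flow + f) ` ?P"
  proof
    fix v assume "v \<in> reroute ` {1..d}"
    then obtain j where "j \<in> {1..d}" "v = reroute j" by blast
    then show "v \<in> (\<lambda>f. - slack_flow + f) ` ?P"
      using vertex by (intro image_eqI[of _ _ "slack_flow + reroute j"]) simp_all
  qed
  then have "span (reroute ` {1..d}) \<subseteq> span ((\<lambda>f. - slack_flow + f) ` ?P)"
    by (rule span_mono)
  ultimately have "span ((\<lambda>f. - slack_flow + f) ` ?P) = span (reroute ` {1..d})" by (rule antisym)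
  then show ?thesis using affine_hull_span_gen[OF hull_inc[OF base]] by simp
qed

text \<open>The coordinates of a point are its own entries at the edges \<open>y j\<close>, so an
  integer point has integer coordinates; conversely \<open>slack_flow\<close> and
  \<open>reroute\<close> have integer entries.\<close>

lemma integer_points_flow_polytope:
  "affine hull flow_polytope G n \<inter> integer_points = (+) slack_flow ` integer_span {1..d} reroute"
proof -
  interpret lattice_basis "{1..d}" reroute by (rule lattice_basis_reroute)
  show ?thesis
  proof (rule antisym; rule subsetI)
    fix f assume f: "f \<in> affine hull flow_polytope G n \<inter> integer_points"
    then obtain v where "f = slack_flow + v" "v \<in> span (reroute ` {1..d})"
      unfolding affine_hull_flow_polytope by blast
    then obtain c where c: "f = flow_of c" using in_span_iff[of v] by blast
    have "c j \<in> \<int>" if "j \<in> {1..d}" for j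
      using f flow_of_y[OF that, of c] c unfolding integer_points_def by (metis IntD2 mem_Collect_eq)
    then have "coordinate_map {1..d} reroute c = coordinate_map {1..d} reroute (\<lambda>j. of_int \<lfloor>c j\<rfloor>)"
      unfolding coordinate_map_def by (intro sum.cong) (auto elim!: Ints_cases)
    then show "f \<in> (+) slack_flow ` integer_span {1..d} reroute"
      using integer_spanI[of "{1..d}" reroute "\<lambda>j. \<lfloor>c j\<rfloor>"] c by simp
  next
    fix f assume "f \<in> (+) slack_flow ` integer_span {1..d} reroute"
    then obtain k where k: "f = flow_of (\<lambda>j. of_int (k j))" by (auto simp: integer_span_def)
    have "f $ e \<in> \<int>" for e
      unfolding k vector_add_component coordinate_map_reroute_nth slack_flow_def
      by (auto intro!: Ints_add Ints_sum Ints_mult Ints_diff)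
    moreover have "f \<in> affine hull flow_polytope G n"
      unfolding affine_hull_flow_polytope k using coordinate_map_in_span by blast
    ultimately show "f \<in> affine hull flow_polytope G n \<inter> integer_points"
      by (simp add: integer_points_def)
  qed
qed

lemma aff_dim_flow_polytope: "aff_dim (flow_polytope G n) = int d"
proof -
  interpret lattice_basis "{1..d}" reroute by (rule lattice_basis_reroute)
  have "aff_dim (flow_polytope G n) = aff_dim ((+) slack_flow ` span (reroute ` {1..d}))"
    using aff_dim_affine_hull[of "flow_polytope G n"] affine_hull_flow_polytope by simp
  also have "\<dots> = int (dim (span (reroute ` {1..d})))"
    by (simp add: aff_dim_translation_eq aff_dim_subspace)
  also have "\<dots> = int (card (reroute ` {1..d}))"
    using independent_b by (simp add: dim_eq_card_independent)
  finally show ?thesis using inj_b by (simp add: card_image)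
qed

section \<open>From cuts to inactive sets\<close>

definition inactive_set :: "nat \<Rightarrow> nat set" where
  "inactive_set j = (if j \<le> d then INACT G y j else {})"

text \<open>Tails increase along the canonical order, so an edge \<open>y k\<close> inactive at
  \<open>j\<close> starts no later than \<open>y j\<close> and ends beyond the tail of
  \<open>y j\<close>.\<close>

lemma INACT_subset_crossing: "j \<in> {1..d} \<Longrightarrow> INACT G y j \<subseteq> crossing (tail G (y j))"
  using tail_mono[of _ j] by (auto simp: INACT_def active_def crossing_def)

text \<open>The witness is the largest index over the cut: its tail is at most \<open>i\<close>, and
  every edge over the cut has its head beyond \<open>i\<close>.\<close>

lemma crossing_subset_INACT:
  assumes "crossing i \<noteq> {}"
  shows "\<exists>j\<in>{1..d}. crossing i \<subseteq> INACT G y j"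
proof (rule bexI)
  let ?j = "Max (crossing i)"
  have j: "?j \<in> crossing i" using assms finite_crossing by simp
  then show "?j \<in> {1..d}" by (simp add: crossing_def)
  show "crossing i \<subseteq> INACT G y ?j"
  proof
    fix k assume k: "k \<in> crossing i"
    then have "k \<le> ?j" using finite_crossing by simp
    then show "k \<in> INACT G y ?j" using j k by (auto simp: INACT_def active_def crossing_def)
  qed
qed

text \<open>Each family of index sets is contained setwise in the other, so for nonnegative
  coordinates the two families of bounds imply each other.\<close>

lemma flow_of_in_polytope_iff_INACT:
  "flow_of c \<in> flow_polytope G n \<longleftrightarrow>
    (\<forall>j\<in>{1..d}. 0 \<le> c j) \<and> (\<forall>j\<in>{1..d}. sum c (inactive_set j) \<le> 1)"
proof -
  have "(\<forall>i\<in>{1..n}. sum c (crossing i) \<le> 1) \<longleftrightarrow> (\<forall>j\<in>{1..d}. sum c (INACT G y j) \<le> 1)"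
    if nonneg: "\<forall>j\<in>{1..d}. 0 \<le> c j"
  proof
    assume L: "\<forall>i\<in>{1..n}. sum c (crossing i) \<le> 1"
    show "\<forall>j\<in>{1..d}. sum c (INACT G y j) \<le> 1"
    proof
      fix j assume j: "j \<in> {1..d}"
      then have "tail G (y j) \<in> {1..n}"
        using arc_bounds[OF y_arc[OF j]] y_tail_less_head[OF j] by simp
      have "sum c (INACT G y j) \<le> sum c (crossing (tail G (y j)))"
        using nonneg by (intro sum_mono2 finite_crossing INACT_subset_crossing j) (auto simp: crossing_def)
      also have "\<dots> \<le> 1" using L \<open>tail G (y j) \<in> {1..n}\<close> by blast
      finally show "sum c (INACT G y j) \<le> 1" .
    qed
  next
    assume R: "\<forall>j\<in>{1..d}. sum c (INACT G y j) \<le> 1"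
    show "\<forall>i\<in>{1..n}. sum c (crossing i) \<le> 1"
    proof
      fix i
      show "sum c (crossing i) \<le> 1"
      proof (cases "crossing i = {}")
        case False
        then obtain j where j: "j \<in> {1..d}" "crossing i \<subseteq> INACT G y j"
          using crossing_subset_INACT by blast
        have "sum c (crossing i) \<le> sum c (INACT G y j)"
          using nonneg j by (intro sum_mono2) (auto simp: INACT_def)
        also have "\<dots> \<le> 1" using R j by blast
        finally show ?thesis .
      qed simp
    qed
  qed
  then show ?thesis
    unfolding flow_of_in_polytope_iff by (auto simp: inactive_set_def)
qed

lemma interval_constraints_inactive_set: "interval_constraints inactive_set d"
proof
  fix j
  show "inactive_set j \<subseteq> {1..j}" by (auto simp: inactive_set_def INACT_def)
  show "j \<in> inactive_set j" if "j \<in> {1..d}"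
    using that y_tail_less_head self_in_INACT[of G y j] by (simp add: inactive_set_def)
  \<comment> \<open>Secured by the cutoff in the definition: beyond \<open>d\<close>,
    \<open>INACT\<close> would depend on values of \<open>y\<close> that label no edge.\<close>
  show "inactive_set j = {}" if "d < j" using that by (simp add: inactive_set_def)
  show "inactive_set (Suc j) \<subseteq> insert (Suc j) (inactive_set j)"
  proof
    fix k assume k: "k \<in> inactive_set (Suc j)"
    then have "Suc j \<le> d" "1 \<le> k" "k \<le> Suc j" "tail G (y (Suc j)) < head G (y k)"
      by (auto simp: inactive_set_def INACT_def active_def split: if_splits)
    \<comment> \<open>An edge ending beyond the tail of \<open>y (Suc j)\<close> also ends beyond
      the earlier tail of \<open>y j\<close>, so it was inactive before.\<close>
    moreover have "tail G (y j) \<le> tail G (y (Suc j))" if "1 \<le> j"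
      using that \<open>Suc j \<le> d\<close> by (intro tail_mono) auto
    ultimately show "k \<in> insert (Suc j) (inactive_set j)"
      by (cases "k = Suc j") (auto simp: inactive_set_def INACT_def active_def)
  qed
qed

text \<open>Active and inactive indices partition \<open>{0..i}\<close>; the entry 0 contributes the
  one that turns the strict bound into a weak one.\<close>

lemma skip_vectors_eq:
  "skip_vectors G d y =
    {t \<in> {1..d} \<rightarrow>\<^sub>E UNIV. \<forall>i\<in>{1..d}. sum t (inactive_set i) \<le> i - card (inactive_set i)}"
proof -
  have "m < card (ACT G y i) \<longleftrightarrow> m \<le> i - card (inactive_set i)" if "i \<in> {1..d}" for i m
  proof -
    have "ACT G y i = insert 0 ({1..i} - INACT G y i)" by (auto simp: ACT_def INACT_def)
    moreover have "INACT G y i \<subseteq> {1..i}" by (auto simp: INACT_def)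
    ultimately have "card (ACT G y i) = Suc (i - card (INACT G y i))"
      by (simp add: card_Diff_subset finite_subset)
    then show ?thesis using that by (simp add: inactive_set_def less_Suc_eq_le)
  qed
  then show ?thesis unfolding skip_vectors_def by (auto simp: inactive_set_def)
qed

lemma normalized_volume_flow_polytope:
  "normalized_volume (flow_polytope G n) = real (card (skip_vectors G d y))"
proof -
  interpret interval_constraints inactive_set d by (rule interval_constraints_inactive_set)
  have borel: "flow_polytope G n \<in> sets borel" using closed_flow_polytope by (rule borel_closed)
  have "relative_volume (flow_polytope G n) =
      measure (Pi\<^sub>M {1..d} (\<lambda>_. lborel)) {c \<in> {1..d} \<rightarrow>\<^sub>E UNIV. flow_of c \<in> flow_polytope G n}"
    by (rule relative_volume_eq[OF lattice_basis_reroute borel integer_points_flow_polytope])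
  also have "\<dots> = real (card (skip_vectors G d y)) * (1 / fact d)"
    unfolding flow_of_in_polytope_iff_INACT measure_def emeasure_constraint_polytope skip_vectors_eq
    by (simp add: enn2real_mult)
  finally show ?thesis
    unfolding normalized_volume_def aff_dim_flow_polytope by simp
qed

end

theorem theorem4p8:
  fixes G :: "(nat, 'e::finite) pre_digraph"
    and n d :: nat
    and x y :: "nat \<Rightarrow> 'e"
  assumes "spinal_graph G n x"
    and "canonical_labeling G n x d y"
  shows "normalized_volume (flow_polytope G n) = real (A_upper G d y) \<and>
         A_upper G d y = A_lower G d y"
proof -
  interpret labeled_spinal_graph G n x d y
    using assms by (intro labeled_spinal_graph.intro labeled_spinal_graph_axioms.intro)
  show ?thesis
    using normalized_volume_flow_polytope A_upper_eq_card_skip_vectors[OF y_tail_less_head]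
      A_lower_eq_card_skip_vectors[OF y_tail_less_head] by simp
qed

end
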